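(* Let $K$ be a field, let $f\colon A\to B$ be a morphism of $K$-coalgebras, let $N$ be a positive integer, and let $\Omega_t=\sum_{n=0}^N\omega_n t^n$, with $\omega_n=(\Delta_{A,n};\,\Delta_{B,n};\,f_n)\in C^2_c(f)$, be a deformation of $f$ of order $N$. For $X\in\{A,B\}$ put $$\mathrm{Ob}_X=\sum_{i=1}^N\Big((\Delta_{X,i}\otimes \mathrm{Id}_X)\circ\Delta_{X,N+1-i}-(\mathrm{Id}_X\otimes\Delta_{X,i})\circ\Delta_{X,N+1-i}\Big),$$ and put $$\mathrm{Ob}_F=\sum_{\substack{i+j+k=N+1\\ 0\le i,j,k\le N}}(f_j\otimes f_k)\circ\Delta_{A,i}\;-\;\sum_{i=1}^N\Delta_{B,N+1-i}\circ f_i .$$ Then the element $\mathrm{Ob}_\Omega=(\mathrm{Ob}_A;\,\mathrm{Ob}_B;\,\mathrm{Ob}_F)\in C^3_c(f)$ is a $3$-cocycle in the deformation complex of $f$, i.e. $d_c\,\mathrm{Ob}_\Omega=0$.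
   Context: Fix a ground field $K$; $\otimes$ and $\mathrm{Hom}$ are over $K$. A $K$-coalgebra is a pair $(A,\Delta_A)$ with $A$ a $K$-vector space and $\Delta_A\colon A\to A\otimes A$ a $K$-linear map that is coassociative: $(\mathrm{Id}\otimes\Delta_A)\Delta_A=(\Delta_A\otimes\mathrm{Id})\Delta_A$ (no counit is required). A morphism $f\colon A\to B$ of coalgebras is a linear map with $\Delta_B\circ f=(f\otimes f)\circ\Delta_A$. Hochschild coalgebra cochains. For a coalgebra $A$ and an $A$-bicomodule $M$ with structure maps $\psi_l\colon M\to A\otimes M$ and $\psi_r\colon M\to M\otimes A$, set $C^n_c(M,A)=\mathrm{Hom}_K(M,A^{\otimes n})$ for $n\ge1$, $C^0_c(M,A)=0$, with differential $\delta_c\colon C^n_c(M,A)\to C^{n+1}_c(M,A)$, $$\delta_c\sigma=(\mathrm{Id}_A\otimes\sigma)\circ\psi_l+\sum_{i=1}^n(-1)^i(\mathrm{Id}_{A^{\otimes(i-1)}}\otimes\Delta_A\otimes\mathrm{Id}_{A^{\otimes(n-i)}})\circ\sigma+(-1)^{n+1}(\sigma\otimes\mathrm{Id}_A)\circ\psi_r .$$ A coalgebra $A$ is a bicomodule over itself with $\psi_l=\psi_r=\Delta_A$. Given a coalgebra morphism $f\colon A\to B$, $A$ is a $B$-bicomodule via $\psi_l=(f\otimes\mathrm{Id}_A)\circ\Delta_A$ and $\psi_r=(\mathrm{Id}_A\otimes f)\circ\Delta_A$; $C^*_c(A,B)$ refers to this structure. Deformation complex of $f$. For $n\ge1$, $C^n_c(f)=C^n_c(A,A)\times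 C^n_c(B,B)\times C^{n-1}_c(A,B)$, with differential $d_c\colon C^n_c(f)\to C^{n+1}_c(f)$, $$d_c(\xi;\pi;\varphi)=\big(\delta_c\xi;\ \delta_c\pi;\ \pi\circ f-f^{\otimes n}\circ\xi-\delta_c\varphi\big).$$ Deformation of order $N$. A deformation of $f$ of order $N$ is a polynomial $\Omega_t=\sum_{n=0}^N\omega_nt^n$ with $\omega_n=(\Delta_{A,n};\Delta_{B,n};f_n)\in C^2_c(f)$ and $\omega_0=(\Delta_A;\Delta_B;f)$ such that, for $X\in\{A,B\}$, $\Delta_{X,t}=\sum_{n=0}^N\Delta_{X,n}t^n$ is coassociative modulo $t^{N+1}$ (so it defines a $K[t]/(t^{N+1})$-coalgebra structure on $X[t]/(t^{N+1})$), and $F_t=\sum_{n=0}^Nf_nt^n$ satisfies $\Delta_{B,t}\circ F_t=(F_t\otimes F_t)\circ\Delta_{A,t}$ modulo $t^{N+1}$ (so it is a $K[t]/(t^{N+1})$-coalgebra morphism). *)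

theory Defs
  imports Complex_Main "HOL-Library.Function_Algebras"
begin

section \<open>Tensor products of vector spaces\<close>

text \<open>
  A \<open>K\<close>-vector space is a type \<open>'a\<close> together with a scalar multiplication
  \<open>sA :: 'k \<Rightarrow> 'a \<Rightarrow> 'a\<close> satisfying \<^const>\<open>vector_space\<close>.

  Tensors are realised as functionals on multilinear forms: a pure tensor of \<open>x\<close> is
  the evaluation \<open>\<beta> \<mapsto> \<beta> x\<close>, and the tensor product is the linear span of the pure tensors
  inside the (pointwise) vector space of functions \<open>('x \<Rightarrow> 'k) \<Rightarrow> 'k\<close>.
  Over a field this has the usual universal property, proved below
  (\<open>tpow_universal\<close>, \<open>tpow_unique\<close>, \<open>tens2_universal\<close>, \<open>tens2_unique\<close>).
\<close>

type_synonym ('x, 'k) tensor = "('x \<Rightarrow> 'k) \<Rightarrow> 'k"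

definition fscale :: "'k::field \<Rightarrow> ('y \<Rightarrow> 'k) \<Rightarrow> 'y \<Rightarrow> 'k" where
  "fscale c g = (\<lambda>y. c * g y)"

text \<open>The domain of \<open>g\<close> consists of words of all lengths at once, and \<open>g\<close> is multilinear on each
  \<open>A\<^sup>n\<close> separately. So the functionals below form the tensor algebra of \<open>A\<close>, and
  \<open>A\<^sup>\<otimes>\<^sup>n\<close> is its component of degree \<open>n\<close>.\<close>

definition multilinear ::
  "('k::field \<Rightarrow> 'a::ab_group_add \<Rightarrow> 'a) \<Rightarrow> ('k \<Rightarrow> 'v::ab_group_add \<Rightarrow> 'v) \<Rightarrow> ('a list \<Rightarrow> 'v) \<Rightarrow> bool" where
  "multilinear sA sV g \<longleftrightarrow> (\<forall>xs ys. Vector_Spaces.linear sA sV (\<lambda>a. g (xs @ a # ys)))"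

definition tpure :: "('k::field \<Rightarrow> 'a::ab_group_add \<Rightarrow> 'a) \<Rightarrow> 'a list \<Rightarrow> ('a list, 'k) tensor" where
  "tpure sA xs = (\<lambda>\<beta>. if multilinear sA (*) \<beta> then \<beta> xs else 0)"

definition tpow :: "('k::field \<Rightarrow> 'a::ab_group_add \<Rightarrow> 'a) \<Rightarrow> nat \<Rightarrow> ('a list, 'k) tensor set" where
  "tpow sA n = module.span fscale {tpure sA xs | xs. length xs = n}"

definition bilinear ::
  "('k::field \<Rightarrow> 'a::ab_group_add \<Rightarrow> 'a) \<Rightarrow> ('k \<Rightarrow> 'b::ab_group_add \<Rightarrow> 'b) \<Rightarrow>
   ('k \<Rightarrow> 'v::ab_group_add \<Rightarrow> 'v) \<Rightarrow> ('a \<times> 'b \<Rightarrow> 'v) \<Rightarrow> bool" where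
  "bilinear sA sB sV g \<longleftrightarrow>
     (\<forall>b. Vector_Spaces.linear sA sV (\<lambda>a. g (a, b))) \<and>
     (\<forall>a. Vector_Spaces.linear sB sV (\<lambda>b. g (a, b)))"

definition pure2 ::
  "('k::field \<Rightarrow> 'a::ab_group_add \<Rightarrow> 'a) \<Rightarrow> ('k \<Rightarrow> 'b::ab_group_add \<Rightarrow> 'b) \<Rightarrow>
   'a \<times> 'b \<Rightarrow> ('a \<times> 'b, 'k) tensor" where
  "pure2 sA sB p = (\<lambda>\<beta>. if bilinear sA sB (*) \<beta> then \<beta> p else 0)"

definition tens2 ::
  "('k::field \<Rightarrow> 'a::ab_group_add \<Rightarrow> 'a) \<Rightarrow> ('k \<Rightarrow> 'b::ab_group_add \<Rightarrow> 'b) \<Rightarrow> ('a \<times> 'b, 'k) tensor set" where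
  "tens2 sA sB = module.span fscale (range (pure2 sA sB))"

text \<open>The linear map on tensors induced by a multilinear map \<open>g\<close> with values in a space of tensors;
  it is determined by \<open>lift_tpure\<close> and \<open>lift_pure2\<close> below.\<close>

definition lift :: "('x \<Rightarrow> ('y, 'k) tensor) \<Rightarrow> ('x, 'k) tensor \<Rightarrow> ('y, 'k) tensor" where
  "lift g t = (\<lambda>\<beta>. t (\<lambda>x. g x \<beta>))"

text \<open>The canonical identification \<open>A = A\<^sup>\<otimes>\<^sup>1\<close>, i.e.\ the identity of \<open>A\<close> regarded as an element
  of \<open>Hom(A, A\<^sup>\<otimes>\<^sup>1)\<close>.\<close>

definition idt :: "('k::field \<Rightarrow> 'a::ab_group_add \<Rightarrow> 'a) \<Rightarrow> 'a \<Rightarrow> ('a list, 'k) tensor" where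
  "idt sA a = tpure sA [a]"

text \<open>The identification \<open>A\<^sup>\<otimes>\<^sup>m \<otimes> A\<^sup>\<otimes>\<^sup>n = A\<^sup>\<otimes>\<^sup>m\<^sup>+\<^sup>n\<close>, as the product of the tensor algebra;
  see \<open>tprod_tpure\<close>.\<close>

definition tprod :: "('k::field \<Rightarrow> 'a::ab_group_add \<Rightarrow> 'a) \<Rightarrow>
  ('a list, 'k) tensor \<Rightarrow> ('a list, 'k) tensor \<Rightarrow> ('a list, 'k) tensor" where
  "tprod sA s t = lift (\<lambda>xs. lift (\<lambda>ys. tpure sA (xs @ ys)) t) s"

text \<open>For linear maps \<open>g\<^sub>i\<close> from \<open>A\<close> to \<open>B\<^sup>\<otimes>\<^sup>m\<^sub>i\<close>, the map
  \<open>g\<^sub>1 \<otimes> \<dots> \<otimes> g\<^sub>r\<close> on \<open>A\<^sup>\<otimes>\<^sup>r\<close> with values in the tensor power of \<open>B\<close> of exponent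
  \<open>m\<^sub>1 + \<dots> + m\<^sub>r\<close> (extended by zero to the other degrees of the tensor algebra of \<open>A\<close>); see \<open>tmap_tpure\<close>.\<close>

definition tmap :: "('k::field \<Rightarrow> 'b::ab_group_add \<Rightarrow> 'b) \<Rightarrow>
  ('a \<Rightarrow> ('b list, 'k) tensor) list \<Rightarrow> ('a list, 'k) tensor \<Rightarrow> ('b list, 'k) tensor" where
  "tmap sB gs = lift (\<lambda>xs. if length xs = length gs
                            then foldr (tprod sB) (map2 (\<lambda>g x. g x) gs xs) (tpure sB [])
                            else 0)"

text \<open>\<open>f \<otimes> g\<close> as a map from \<open>A\<^sup>\<otimes>\<^sup>2\<close> to \<open>V \<otimes> W\<close>, where \<open>A\<close>, \<open>V\<close>, \<open>W\<close> may be different spaces; see \<open>map2t_tpure\<close>.\<close>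

definition map2t ::
  "('k::field \<Rightarrow> 'v::ab_group_add \<Rightarrow> 'v) \<Rightarrow> ('k \<Rightarrow> 'w::ab_group_add \<Rightarrow> 'w) \<Rightarrow>
   ('a \<Rightarrow> 'v) \<Rightarrow> ('a \<Rightarrow> 'w) \<Rightarrow> ('a list, 'k) tensor \<Rightarrow> ('v \<times> 'w, 'k) tensor" where
  "map2t sV sW f g = lift (\<lambda>xs. case xs of [x, y] \<Rightarrow> pure2 sV sW (f x, g y) | _ \<Rightarrow> 0)"


section \<open>Coalgebras and Hochschild cochains\<close>

definition coalgebra ::
  "('k::field \<Rightarrow> 'a::ab_group_add \<Rightarrow> 'a) \<Rightarrow> ('a \<Rightarrow> ('a list, 'k) tensor) \<Rightarrow> bool" where
  "coalgebra sA D \<longleftrightarrow>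
     vector_space sA \<and> Vector_Spaces.linear sA fscale D \<and> range D \<subseteq> tpow sA 2 \<and>
     tmap sA [idt sA, D] \<circ> D = tmap sA [D, idt sA] \<circ> D"

definition coalgebra_morphism ::
  "('k::field \<Rightarrow> 'a::ab_group_add \<Rightarrow> 'a) \<Rightarrow> ('a \<Rightarrow> ('a list, 'k) tensor) \<Rightarrow>
   ('k \<Rightarrow> 'b::ab_group_add \<Rightarrow> 'b) \<Rightarrow> ('b \<Rightarrow> ('b list, 'k) tensor) \<Rightarrow> ('a \<Rightarrow> 'b) \<Rightarrow> bool" where
  "coalgebra_morphism sA DA sB DB f \<longleftrightarrow>
     Vector_Spaces.linear sA sB f \<and>
     DB \<circ> f = tmap sB [idt sB \<circ> f, idt sB \<circ> f] \<circ> DA"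

definition coch ::
  "('k::field \<Rightarrow> 'm::ab_group_add \<Rightarrow> 'm) \<Rightarrow> ('k \<Rightarrow> 'a::ab_group_add \<Rightarrow> 'a) \<Rightarrow> nat \<Rightarrow>
   ('m \<Rightarrow> ('a list, 'k) tensor) set" where
  "coch sM sA n = (if n = 0 then {0}
     else {\<sigma>. Vector_Spaces.linear sM fscale \<sigma> \<and> range \<sigma> \<subseteq> tpow sA n})"

definition coch_diff ::
  "('k::field \<Rightarrow> 'a::ab_group_add \<Rightarrow> 'a) \<Rightarrow> ('a \<Rightarrow> ('a list, 'k) tensor) \<Rightarrow>
   ('m \<Rightarrow> ('a \<times> 'm, 'k) tensor) \<Rightarrow> ('m \<Rightarrow> ('m \<times> 'a, 'k) tensor) \<Rightarrow> nat \<Rightarrow>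
   ('m \<Rightarrow> ('a list, 'k) tensor) \<Rightarrow> 'm \<Rightarrow> ('a list, 'k) tensor" where
  "coch_diff sA D \<psi>l \<psi>r n \<sigma> = (\<lambda>m.
     lift (\<lambda>(a, x). tprod sA (idt sA a) (\<sigma> x)) (\<psi>l m)
     + (\<Sum>i = 1..n. fscale ((-1) ^ i)
          (tmap sA (replicate (i - 1) (idt sA) @ [D] @ replicate (n - i) (idt sA)) (\<sigma> m)))
     + fscale ((-1) ^ (n + 1)) (lift (\<lambda>(x, a). tprod sA (\<sigma> x) (idt sA a)) (\<psi>r m)))"

text \<open>\<open>\<delta>\<^sub>c\<close> on \<open>C\<^sup>n(A, B)\<close> with the \<open>B\<close>-bicomodule structure on \<open>A\<close> given by \<open>f\<close>. The structure of
  \<open>A\<close> as a bicomodule over itself is the case \<open>f = id\<close>, where \<open>map2t sA sA id id\<close> is the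
  identification of \<open>A\<^sup>\<otimes>\<^sup>2\<close> with \<open>A \<otimes> A\<close>.\<close>

definition diff_mor ::
  "('k::field \<Rightarrow> 'a::ab_group_add \<Rightarrow> 'a) \<Rightarrow> ('a \<Rightarrow> ('a list, 'k) tensor) \<Rightarrow>
   ('k \<Rightarrow> 'b::ab_group_add \<Rightarrow> 'b) \<Rightarrow> ('b \<Rightarrow> ('b list, 'k) tensor) \<Rightarrow> ('a \<Rightarrow> 'b) \<Rightarrow> nat \<Rightarrow>
   ('a \<Rightarrow> ('b list, 'k) tensor) \<Rightarrow> 'a \<Rightarrow> ('b list, 'k) tensor" where
  "diff_mor sA DA sB DB f = coch_diff sB DB (map2t sB sA f id \<circ> DA) (map2t sA sB id f \<circ> DA)"

definition diff_self ::
  "('k::field \<Rightarrow> 'a::ab_group_add \<Rightarrow> 'a) \<Rightarrow> ('a \<Rightarrow> ('a list, 'k) tensor) \<Rightarrow> nat \<Rightarrow>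
   ('a \<Rightarrow> ('a list, 'k) tensor) \<Rightarrow> 'a \<Rightarrow> ('a list, 'k) tensor" where
  "diff_self sA DA = coch_diff sA DA (map2t sA sA id id \<circ> DA) (map2t sA sA id id \<circ> DA)"


section \<open>The deformation complex of a morphism\<close>

text \<open>\<open>C\<^sup>n(f)\<close> for \<open>n \<ge> 1\<close>; as a set it depends only on the vector spaces.\<close>

definition def_coch ::
  "('k::field \<Rightarrow> 'a::ab_group_add \<Rightarrow> 'a) \<Rightarrow> ('k \<Rightarrow> 'b::ab_group_add \<Rightarrow> 'b) \<Rightarrow> nat \<Rightarrow>
   (('a \<Rightarrow> ('a list, 'k) tensor) \<times> ('b \<Rightarrow> ('b list, 'k) tensor) \<times> ('a \<Rightarrow> ('b list, 'k) tensor)) set" where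
  "def_coch sA sB n = coch sA sA n \<times> coch sB sB n \<times> coch sA sB (n - 1)"

definition def_diff ::
  "('k::field \<Rightarrow> 'a::ab_group_add \<Rightarrow> 'a) \<Rightarrow> ('a \<Rightarrow> ('a list, 'k) tensor) \<Rightarrow>
   ('k \<Rightarrow> 'b::ab_group_add \<Rightarrow> 'b) \<Rightarrow> ('b \<Rightarrow> ('b list, 'k) tensor) \<Rightarrow> ('a \<Rightarrow> 'b) \<Rightarrow> nat \<Rightarrow>
   ('a \<Rightarrow> ('a list, 'k) tensor) \<times> ('b \<Rightarrow> ('b list, 'k) tensor) \<times> ('a \<Rightarrow> ('b list, 'k) tensor) \<Rightarrow>
   ('a \<Rightarrow> ('a list, 'k) tensor) \<times> ('b \<Rightarrow> ('b list, 'k) tensor) \<times> ('a \<Rightarrow> ('b list, 'k) tensor)" where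
  "def_diff sA DA sB DB f n = (\<lambda>(\<xi>, \<pi>, \<phi>).
     (diff_self sA DA n \<xi>,
      diff_self sB DB n \<pi>,
      (\<pi> \<circ> f) - (tmap sB (replicate n (idt sB \<circ> f)) \<circ> \<xi>) - diff_mor sA DA sB DB f (n - 1) \<phi>))"


section \<open>Deformations of order \<open>N\<close>\<close>

text \<open>A polynomial of degree at most \<open>N\<close> in \<open>t\<close> is given by its coefficients of index \<open>0, \<dots>, N\<close>
  (values at larger indices are never used), and an equation modulo \<open>t\<^sup>N\<^sup>+\<^sup>1\<close> is the family of
  equations between the coefficients of \<open>t\<^sup>m\<close> for \<open>m \<le> N\<close>. The coefficients \<open>f\<^sub>n\<close> are given as maps
  from \<open>A\<close> to \<open>B\<close>; the corresponding element of \<open>C\<^sup>1(A, B)\<close> is \<open>idt sB \<circ> f\<^sub>n\<close>.\<close>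

definition coassociative_mod ::
  "('k::field \<Rightarrow> 'a::ab_group_add \<Rightarrow> 'a) \<Rightarrow> nat \<Rightarrow> (nat \<Rightarrow> 'a \<Rightarrow> ('a list, 'k) tensor) \<Rightarrow> bool" where
  "coassociative_mod sA N D \<longleftrightarrow> (\<forall>m\<le>N.
     (\<Sum>(i, j)\<in>{(i, j). i \<le> N \<and> j \<le> N \<and> i + j = m}. tmap sA [idt sA, D i] \<circ> D j)
     = (\<Sum>(i, j)\<in>{(i, j). i \<le> N \<and> j \<le> N \<and> i + j = m}. tmap sA [D i, idt sA] \<circ> D j))"

definition morphism_mod ::
  "('k::field \<Rightarrow> 'b::ab_group_add \<Rightarrow> 'b) \<Rightarrow> nat \<Rightarrow> (nat \<Rightarrow> 'a \<Rightarrow> ('a list, 'k) tensor) \<Rightarrow>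
   (nat \<Rightarrow> 'b \<Rightarrow> ('b list, 'k) tensor) \<Rightarrow> (nat \<Rightarrow> 'a \<Rightarrow> 'b) \<Rightarrow> bool" where
  "morphism_mod sB N DA DB F \<longleftrightarrow> (\<forall>m\<le>N.
     (\<Sum>(i, j)\<in>{(i, j). i \<le> N \<and> j \<le> N \<and> i + j = m}. DB i \<circ> F j)
     = (\<Sum>(i, j, k)\<in>{(i, j, k). i \<le> N \<and> j \<le> N \<and> k \<le> N \<and> i + j + k = m}.
          tmap sB [idt sB \<circ> F j, idt sB \<circ> F k] \<circ> DA i))"

definition deformation ::
  "('k::field \<Rightarrow> 'a::ab_group_add \<Rightarrow> 'a) \<Rightarrow> ('a \<Rightarrow> ('a list, 'k) tensor) \<Rightarrow>
   ('k \<Rightarrow> 'b::ab_group_add \<Rightarrow> 'b) \<Rightarrow> ('b \<Rightarrow> ('b list, 'k) tensor) \<Rightarrow> ('a \<Rightarrow> 'b) \<Rightarrow> nat \<Rightarrow>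
   (nat \<Rightarrow> 'a \<Rightarrow> ('a list, 'k) tensor) \<Rightarrow> (nat \<Rightarrow> 'b \<Rightarrow> ('b list, 'k) tensor) \<Rightarrow>
   (nat \<Rightarrow> 'a \<Rightarrow> 'b) \<Rightarrow> bool" where
  "deformation sA \<Delta>A sB \<Delta>B f N DA DB F \<longleftrightarrow>
     (\<forall>n\<le>N. (DA n, DB n, idt sB \<circ> F n) \<in> def_coch sA sB 2) \<and>
     DA 0 = \<Delta>A \<and> DB 0 = \<Delta>B \<and> F 0 = f \<and>
     coassociative_mod sA N DA \<and> coassociative_mod sB N DB \<and> morphism_mod sB N DA DB F"

definition ob_coalg ::
  "('k::field \<Rightarrow> 'a::ab_group_add \<Rightarrow> 'a) \<Rightarrow> nat \<Rightarrow> (nat \<Rightarrow> 'a \<Rightarrow> ('a list, 'k) tensor) \<Rightarrow>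
   'a \<Rightarrow> ('a list, 'k) tensor" where
  "ob_coalg sA N D =
     (\<Sum>i = 1..N. (tmap sA [D i, idt sA] \<circ> D (N + 1 - i)) - (tmap sA [idt sA, D i] \<circ> D (N + 1 - i)))"

definition ob_mor ::
  "('k::field \<Rightarrow> 'b::ab_group_add \<Rightarrow> 'b) \<Rightarrow> nat \<Rightarrow> (nat \<Rightarrow> 'a \<Rightarrow> ('a list, 'k) tensor) \<Rightarrow>
   (nat \<Rightarrow> 'b \<Rightarrow> ('b list, 'k) tensor) \<Rightarrow> (nat \<Rightarrow> 'a \<Rightarrow> 'b) \<Rightarrow> 'a \<Rightarrow> ('b list, 'k) tensor" where
  "ob_mor sB N DA DB F =
     (\<Sum>(i, j, k)\<in>{(i, j, k). i + j + k = N + 1 \<and> i \<le> N \<and> j \<le> N \<and> k \<le> N}.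
        tmap sB [idt sB \<circ> F j, idt sB \<circ> F k] \<circ> DA i)
     - (\<Sum>i = 1..N. DB (N + 1 - i) \<circ> F i)"


section \<open>Basic facts about the tensor constructions\<close>

lemma vector_space_fscale: "vector_space fscale"
  by unfold_locales (auto simp: fscale_def fun_eq_iff algebra_simps)

lemma vector_space_times: "vector_space ((*) :: 'k::field \<Rightarrow> 'k \<Rightarrow> 'k)"
  by unfold_locales (auto simp: algebra_simps)

lemma multilinear_compose:
  assumes "multilinear sA sV g" "Vector_Spaces.linear sV sW \<phi>"
  shows "multilinear sA sW (\<lambda>xs. \<phi> (g xs))"
  using assms Vector_Spaces.linear_compose unfolding multilinear_def comp_def by blast

lemma bilinear_compose:
  assumes "bilinear sA sB sV g" "Vector_Spaces.linear sV sW \<phi>"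
  shows "bilinear sA sB sW (\<lambda>p. \<phi> (g p))"
  unfolding bilinear_def
proof (intro conjI allI)
  show "Vector_Spaces.linear sA sW (\<lambda>a. \<phi> (g (a, b)))" for b
    using Vector_Spaces.linear_compose[of sA sV "\<lambda>a. g (a, b)" sW \<phi>] assms
    by (simp add: bilinear_def comp_def)
  show "Vector_Spaces.linear sB sW (\<lambda>b. \<phi> (g (a, b)))" for a
    using Vector_Spaces.linear_compose[of sB sV "\<lambda>b. g (a, b)" sW \<phi>] assms
    by (simp add: bilinear_def comp_def)
qed

lemma linear_apply: "Vector_Spaces.linear fscale (*) (\<lambda>t :: ('x, 'k::field) tensor. t \<beta>)"
  by (simp add: Vector_Spaces.linear_iff vector_space_fscale vector_space_times) (simp add: fscale_def)

lemma linear_lift: "Vector_Spaces.linear fscale fscale (lift g :: ('x, 'k::field) tensor \<Rightarrow> _)"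
  by (simp add: Vector_Spaces.linear_iff vector_space_fscale) (auto simp: lift_def fscale_def fun_eq_iff)

lemma lift_tpure:
  assumes "multilinear sA fscale g"
  shows "lift g (tpure sA xs) = g xs"
  using multilinear_compose[OF assms linear_apply] by (auto simp: lift_def tpure_def fun_eq_iff)

lemma lift_pure2:
  assumes "bilinear sA sB fscale g"
  shows "lift g (pure2 sA sB p) = g p"
  using bilinear_compose[OF assms linear_apply] by (auto simp: lift_def pure2_def fun_eq_iff)

lemma multilinear_tpure:
  assumes "vector_space sA"
  shows "multilinear sA fscale (tpure sA)"
proof -
  have "Vector_Spaces.linear sA fscale (\<lambda>a. tpure sA (xs @ a # ys))" for xs ys
  proof -
    have *: "multilinear sA (*) \<beta> \<Longrightarrow>
        \<beta> (xs @ (a + b) # ys) = \<beta> (xs @ a # ys) + \<beta> (xs @ b # ys) \<and>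
        \<beta> (xs @ sA c a # ys) = c * \<beta> (xs @ a # ys)" for \<beta> a b c
      unfolding multilinear_def Vector_Spaces.linear_iff by blast
    show ?thesis
      unfolding Vector_Spaces.linear_iff
      using assms vector_space_fscale * by (auto simp: tpure_def fscale_def fun_eq_iff)
  qed
  then show ?thesis unfolding multilinear_def by blast
qed

lemma bilinear_pure2:
  assumes "vector_space sA" "vector_space sB"
  shows "bilinear sA sB fscale (pure2 sA sB)"
proof -
  have *: "\<beta> (a + a', b) = \<beta> (a, b) + \<beta> (a', b)" "\<beta> (sA c a, b) = c * \<beta> (a, b)"
      "\<beta> (a, b + b') = \<beta> (a, b) + \<beta> (a, b')" "\<beta> (a, sB c b) = c * \<beta> (a, b)"
    if "bilinear sA sB (*) \<beta>" for \<beta> a a' b b' c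
    using that unfolding bilinear_def Vector_Spaces.linear_iff by blast+
  show ?thesis
    unfolding bilinear_def[of _ _ fscale] Vector_Spaces.linear_iff
    using assms vector_space_fscale * by (auto simp: pure2_def fscale_def fun_eq_iff)
qed

lemma tprod_tpure:
  assumes "vector_space sA"
  shows "tprod sA (tpure sA xs) (tpure sA ys) = tpure sA (xs @ ys)"
proof -
  have m: "Vector_Spaces.linear sA fscale (\<lambda>a. tpure sA (us @ a # vs))" for us vs
    using multilinear_tpure[OF assms] unfolding multilinear_def by blast
  have 1: "multilinear sA fscale (\<lambda>ys. tpure sA (xs @ ys))" for xs
    unfolding multilinear_def using m by (simp flip: append_assoc)
  have 2: "multilinear sA fscale (\<lambda>xs. tpure sA (xs @ ys))" for ys
    unfolding multilinear_def using m by simp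
  show ?thesis
    unfolding tprod_def lift_tpure[OF 1] by (rule lift_tpure[OF 2])
qed

lemma linear_tprod_left: "Vector_Spaces.linear fscale fscale (\<lambda>s. tprod sA s t)"
  unfolding tprod_def by (rule linear_lift)

lemma tprod_tpure_left:
  fixes sA :: "'k::field \<Rightarrow> 'a::ab_group_add \<Rightarrow> 'a"
  assumes A: "vector_space sA" and t: "t \<in> module.span fscale (range (tpure sA))"
  shows "tprod sA (tpure sA xs) t = lift (\<lambda>ys. tpure sA (xs @ ys)) t"
proof -
  interpret T: vector_space "fscale :: 'k \<Rightarrow> ('a list, 'k) tensor \<Rightarrow> _" by (rule vector_space_fscale)
  interpret AT: vector_space_pair sA "fscale :: 'k \<Rightarrow> ('a list, 'k) tensor \<Rightarrow> _"
    by (intro vector_space_pair.intro A vector_space_fscale)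
  have m: "Vector_Spaces.linear sA fscale (\<lambda>a. tpure sA (us @ a # vs))" for us vs
    using multilinear_tpure[OF A] unfolding multilinear_def by blast
  have pure: "lift (\<lambda>ys. tpure sA (xs @ ys)) (tpure sA zs) = tpure sA (xs @ zs)" for xs zs
  proof -
    have "multilinear sA fscale (\<lambda>ys. tpure sA (xs @ ys))"
      unfolding multilinear_def using m by (simp flip: append_assoc)
    from lift_tpure[OF this] show ?thesis .
  qed
  have l0: "lift g 0 = 0" and ladd: "lift g (u + v) = lift g u + lift g v"
    and lsc: "lift g (fscale c u) = fscale c (lift g u)"
    for g :: "'a list \<Rightarrow> ('a list, 'k) tensor" and u v c
    by (simp_all add: lift_def fscale_def fun_eq_iff)
  have "multilinear sA fscale (\<lambda>us. lift (\<lambda>ys. tpure sA (us @ ys)) t)"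
    using t
  proof (induction rule: T.span_induct_alt)
    case base
    show ?case unfolding multilinear_def l0 using AT.linear_zero by blast
  next
    case (step c x y)
    then obtain zs where x: "x = tpure sA zs" by auto
    show ?case
      unfolding multilinear_def ladd lsc
    proof (intro allI AT.linear_compose_add AT.linear_compose_scale_right)
      fix us vs
      show "Vector_Spaces.linear sA fscale (\<lambda>a. lift (\<lambda>ys. tpure sA ((us @ a # vs) @ ys)) x)"
        unfolding x pure using m[of us "vs @ zs"] by simp
      show "Vector_Spaces.linear sA fscale (\<lambda>a. lift (\<lambda>ys. tpure sA ((us @ a # vs) @ ys)) y)"
        using step.IH unfolding multilinear_def by blast
    qed
  qed
  from lift_tpure[OF this] show ?thesis unfolding tprod_def by simp
qed

lemma linear_tprod_right:
  fixes sA :: "'k::field \<Rightarrow> 'a::ab_group_add \<Rightarrow> 'a" and sV :: "'k \<Rightarrow> 'v::ab_group_add \<Rightarrow> 'v"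
  assumes A: "vector_space sA" and s: "s \<in> module.span fscale (range (tpure sA))"
    and R: "Vector_Spaces.linear sV fscale R" "\<And>v. R v \<in> module.span fscale (range (tpure sA))"
  shows "Vector_Spaces.linear sV fscale (\<lambda>v. tprod sA s (R v))"
proof -
  interpret T: vector_space "fscale :: 'k \<Rightarrow> ('a list, 'k) tensor \<Rightarrow> _" by (rule vector_space_fscale)
  have V: "vector_space sV" using R(1) by (simp add: Vector_Spaces.linear_iff)
  interpret VT: vector_space_pair sV "fscale :: 'k \<Rightarrow> ('a list, 'k) tensor \<Rightarrow> _"
    by (intro vector_space_pair.intro V vector_space_fscale)
  have l0: "tprod sA 0 t = 0" and ladd: "tprod sA (u + v) t = tprod sA u t + tprod sA v t"
    and lsc: "tprod sA (fscale c u) t = fscale c (tprod sA u t)" for t u v c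
    by (simp_all add: tprod_def lift_def fscale_def fun_eq_iff)
  from s show ?thesis
  proof (induction rule: T.span_induct_alt)
    case base
    show ?case unfolding l0 by (rule VT.linear_zero)
  next
    case (step c x y)
    then obtain xs where x: "x = tpure sA xs" by auto
    have "Vector_Spaces.linear sV fscale (\<lambda>v. tprod sA x (R v))"
      unfolding x tprod_tpure_left[OF A R(2)]
      using Vector_Spaces.linear_compose[OF R(1) linear_lift] by (simp add: comp_def)
    then show ?case
      unfolding ladd lsc by (intro VT.linear_compose_add VT.linear_compose_scale_right step.IH)
  qed
qed

lemma tprod_in_span:
  fixes sA :: "'k::field \<Rightarrow> 'a::ab_group_add \<Rightarrow> 'a"
  assumes A: "vector_space sA"
    and s: "s \<in> module.span fscale (range (tpure sA))"
    and t: "t \<in> module.span fscale (range (tpure sA))"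
  shows "tprod sA s t \<in> module.span fscale (range (tpure sA))"
proof -
  interpret T: vector_space "fscale :: 'k \<Rightarrow> ('a list, 'k) tensor \<Rightarrow> _" by (rule vector_space_fscale)
  have l0: "tprod sA 0 t = 0" and ladd: "tprod sA (u + v) t = tprod sA u t + tprod sA v t"
    and lsc: "tprod sA (fscale c u) t = fscale c (tprod sA u t)" for t u v c
    by (simp_all add: tprod_def lift_def fscale_def fun_eq_iff)
  have r0: "lift g 0 = 0" and radd: "lift g (u + v) = lift g u + lift g v"
    and rsc: "lift g (fscale c u) = fscale c (lift g u)"
    for g :: "'a list \<Rightarrow> ('a list, 'k) tensor" and u v c
    by (simp_all add: lift_def fscale_def fun_eq_iff)
  have pure: "lift (\<lambda>ys. tpure sA (xs @ ys)) t \<in> T.span (range (tpure sA))" for xs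
    using t
  proof (induction rule: T.span_induct_alt)
    case base
    show ?case unfolding r0 by (rule T.span_zero)
  next
    case (step c x y)
    then obtain ys where x: "x = tpure sA ys" by auto
    have "lift (\<lambda>ys. tpure sA (xs @ ys)) x = tpure sA (xs @ ys)"
      unfolding x tprod_tpure_left[OF A T.span_base[OF rangeI], symmetric] by (rule tprod_tpure[OF A])
    with step.IH show ?case
      unfolding radd rsc by (metis T.span_add T.span_scale T.span_base rangeI)
  qed
  from s show ?thesis
  proof (induction rule: T.span_induct_alt)
    case base
    show ?case unfolding l0 by (rule T.span_zero)
  next
    case (step c x y)
    then obtain xs where "x = tpure sA xs" by auto
    with pure step.IH show ?case
      unfolding ladd lsc by (metis tprod_tpure_left[OF A t] T.span_add T.span_scale)
  qed
qed

lemma tmap_tpure: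
  fixes sA :: "'k::field \<Rightarrow> 'a::ab_group_add \<Rightarrow> 'a" and sB :: "'k \<Rightarrow> 'b::ab_group_add \<Rightarrow> 'b"
  assumes gs: "\<And>g. g \<in> set gs \<Longrightarrow> Vector_Spaces.linear sA fscale g"
    and sp: "\<And>g x. g \<in> set gs \<Longrightarrow> g x \<in> module.span fscale (range (tpure sB))"
    and A: "vector_space sA" and B: "vector_space sB" and len: "length xs = length gs"
  shows "tmap sB gs (tpure sA xs) = foldr (tprod sB) (map2 (\<lambda>g x. g x) gs xs) (tpure sB [])"
proof -
  let ?R = "\<lambda>gs xs. foldr (tprod sB) (map2 (\<lambda>g x. g x) gs xs) (tpure sB [])"
  interpret T: vector_space "fscale :: 'k \<Rightarrow> ('b list, 'k) tensor \<Rightarrow> _" by (rule vector_space_fscale)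
  interpret AT: vector_space_pair sA "fscale :: 'k \<Rightarrow> ('b list, 'k) tensor \<Rightarrow> _"
    by (intro vector_space_pair.intro A vector_space_fscale)
  have R: "?R gs xs \<in> T.span (range (tpure sB))"
    if "\<And>g x. g \<in> set gs \<Longrightarrow> g x \<in> T.span (range (tpure sB))" for gs :: "('a \<Rightarrow> _) list" and xs
    using that
  proof (induction gs arbitrary: xs)
    case Nil
    show ?case by (simp add: T.span_base)
  next
    case (Cons g gs)
    then show ?case by (cases xs) (simp_all add: T.span_base tprod_in_span[OF B])
  qed
  have lin: "Vector_Spaces.linear sA fscale (\<lambda>a. ?R gs (us @ a # vs))"
    if "length gs = length us + length vs + 1" for us vs
    using that gs sp
  proof (induction gs arbitrary: us)
    case Nil
    then show ?case by simp
  next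
    case (Cons g gs)
    show ?case
    proof (cases us)
      case Nil
      then show ?thesis
        using Vector_Spaces.linear_compose[OF Cons.prems(2)[of g] linear_tprod_left[of sB "?R gs vs"]]
        by (simp add: comp_def)
    next
      case (Cons u us')
      have "Vector_Spaces.linear sA fscale (\<lambda>a. ?R gs (us' @ a # vs))"
        using Cons.IH Cons.prems \<open>us = u # us'\<close> by simp
      from linear_tprod_right[OF B Cons.prems(3)[of g u] this R] Cons.prems(3)
      show ?thesis using \<open>us = u # us'\<close> by simp
    qed
  qed
  have "multilinear sA fscale (\<lambda>xs. if length xs = length gs then ?R gs xs else 0)"
    unfolding multilinear_def
  proof (intro allI)
    fix us vs :: "'a list"
    show "Vector_Spaces.linear sA fscale
        (\<lambda>a. if length (us @ a # vs) = length gs then ?R gs (us @ a # vs) else 0)"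
      using lin[of us vs] AT.linear_zero
      by (cases "length gs = length us + length vs + 1") (simp_all del: foldr.simps)
  qed
  from lift_tpure[OF this] len show ?thesis by (simp add: tmap_def)
qed

lemma map2t_tpure:
  fixes sA :: "'k::field \<Rightarrow> 'a::ab_group_add \<Rightarrow> 'a"
  assumes f: "Vector_Spaces.linear sA sV f" and g: "Vector_Spaces.linear sA sW g"
  shows "map2t sV sW f g (tpure sA [x, y]) = pure2 sV sW (f x, g y)"
proof -
  have A: "vector_space sA" using f by (simp add: Vector_Spaces.linear_iff)
  interpret AT: vector_space_pair sA "fscale :: 'k \<Rightarrow> ('b \<times> 'c, 'k) tensor \<Rightarrow> _"
    by (intro vector_space_pair.intro A vector_space_fscale)
  let ?h = "\<lambda>xs. case xs of [x, y] \<Rightarrow> pure2 sV sW (f x, g y) | _ \<Rightarrow> 0"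
  have VW: "bilinear sV sW fscale (pure2 sV sW)"
    using f g by (intro bilinear_pure2) (simp_all add: Vector_Spaces.linear_iff)
  have l: "Vector_Spaces.linear sA fscale (\<lambda>a. pure2 sV sW (f a, g y))" for y
    using Vector_Spaces.linear_compose[OF f, of fscale "\<lambda>v. pure2 sV sW (v, g y)"] VW
    by (simp add: bilinear_def comp_def)
  have r: "Vector_Spaces.linear sA fscale (\<lambda>a. pure2 sV sW (f x, g a))" for x
    using Vector_Spaces.linear_compose[OF g, of fscale "\<lambda>w. pure2 sV sW (f x, w)"] VW
    by (simp add: bilinear_def comp_def)
  have "multilinear sA fscale ?h"
    unfolding multilinear_def
  proof (intro allI)
    fix us vs :: "'a list"
    consider "us = []" "vs = []" | y where "us = []" "vs = [y]" | x where "us = [x]" "vs = []"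
      | x y vs' where "us = [x]" "vs = y # vs'" | y z vs' where "us = []" "vs = y # z # vs'"
      | x y us' where "us = x # y # us'"
      by (metis neq_Nil_conv)
    then show "Vector_Spaces.linear sA fscale (\<lambda>a. ?h (us @ a # vs))"
    proof cases
      case 6
      then show ?thesis using AT.linear_zero by (cases us') (simp_all add: neq_Nil_conv split: list.split)
    qed (use l r AT.linear_zero in simp_all)
  qed
  from lift_tpure[OF this] show ?thesis by (simp add: map2t_def)
qed

lemma evaluation_universal:
  fixes P :: "('x \<Rightarrow> 'k::field) \<Rightarrow> bool" and sV :: "'k \<Rightarrow> 'v::ab_group_add \<Rightarrow> 'v"
  defines "ev \<equiv> \<lambda>x \<beta>. if P \<beta> then \<beta> x else 0"
  assumes V: "vector_space sV"
    and P: "\<And>\<phi>. Vector_Spaces.linear sV (*) \<phi> \<Longrightarrow> P (\<lambda>x. \<phi> (g x))"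
  shows "\<exists>L. Vector_Spaces.linear fscale sV L \<and> (\<forall>x. L (ev x) = g x)"
proof -
  interpret T: vector_space "fscale :: 'k \<Rightarrow> (('x \<Rightarrow> 'k) \<Rightarrow> 'k) \<Rightarrow> _" by (rule vector_space_fscale)
  interpret V: vector_space sV by (rule V)
  interpret TV: vector_space_pair "fscale :: 'k \<Rightarrow> (('x \<Rightarrow> 'k) \<Rightarrow> 'k) \<Rightarrow> _" sV by unfold_locales
  interpret VK: vector_space_pair sV "(*) :: 'k \<Rightarrow> 'k \<Rightarrow> 'k"
    by (intro vector_space_pair.intro V vector_space_times)
  obtain B where B: "B \<subseteq> range ev" "T.independent B" "range ev \<subseteq> T.span B"
    using T.maximal_independent_subset[of "range ev"] by blast
  obtain L where L: "Vector_Spaces.linear fscale sV L" "\<And>b. b \<in> B \<Longrightarrow> L b = g (inv ev b)"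
    using TV.linear_independent_extend[OF B(2), of "\<lambda>b. g (inv ev b)"] by blast
  have sep: "v = 0" if "\<And>\<phi>. Vector_Spaces.linear sV (*) \<phi> \<Longrightarrow> \<phi> v = 0" for v
  proof (rule ccontr)
    assume "v \<noteq> 0"
    then have "V.independent {v}" by simp
    from VK.linear_independent_extend[OF this, of "\<lambda>_. 1"]
    obtain \<phi> where "Vector_Spaces.linear sV (*) \<phi>" "\<phi> v = 1" by auto
    with that show False by force
  qed
  have ev_form: "\<phi> (L t) = t (\<lambda>x. \<phi> (g x))"
    if \<phi>: "Vector_Spaces.linear sV (*) \<phi>" and t: "t \<in> T.span B" for \<phi> t
  proof -
    interpret TK: vector_space_pair "fscale :: 'k \<Rightarrow> (('x \<Rightarrow> 'k) \<Rightarrow> 'k) \<Rightarrow> _" "(*) :: 'k \<Rightarrow> 'k \<Rightarrow> 'k"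
      by (intro vector_space_pair.intro vector_space_fscale vector_space_times)
    have 1: "Vector_Spaces.linear fscale (*) (\<lambda>t. \<phi> (L t))"
      using Vector_Spaces.linear_compose[OF L(1) \<phi>] by (simp add: comp_def)
    have "\<phi> (L b) = b (\<lambda>x. \<phi> (g x))" if b: "b \<in> B" for b
    proof -
      have e: "ev (inv ev b) = b" using b B(1) by (meson f_inv_into_f subsetD)
      have "b (\<lambda>x. \<phi> (g x)) = ev (inv ev b) (\<lambda>x. \<phi> (g x))" by (simp only: e)
      also have "\<dots> = \<phi> (g (inv ev b))" using P[OF \<phi>] by (simp add: ev_def)
      finally show ?thesis using L(2)[OF b] by simp
    qed
    then show ?thesis using TK.linear_eq_on[OF 1 linear_apply t] by blast
  qed
  have "L (ev x) = g x" for x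
  proof -
    have "L (ev x) - g x = 0"
    proof (rule sep)
      fix \<phi> assume \<phi>: "Vector_Spaces.linear sV ((*) :: 'k \<Rightarrow> _) \<phi>"
      have "\<phi> (L (ev x)) = \<phi> (g x)"
        using ev_form[OF \<phi>, of "ev x"] B(3) P[OF \<phi>] by (auto simp: ev_def)
      then show "\<phi> (L (ev x) - g x) = 0"
        using VK.linear_diff[OF \<phi>] by simp
    qed
    then show ?thesis by simp
  qed
  with L(1) show ?thesis by blast
qed

lemma tpow_universal:
  assumes A: "vector_space sA" and V: "vector_space sV"
    and g: "\<And>xs ys. length xs + length ys + 1 = n \<Longrightarrow>
              Vector_Spaces.linear sA sV (\<lambda>a. g (xs @ a # ys))"
  shows "\<exists>L. Vector_Spaces.linear fscale sV L \<and> (\<forall>xs. length xs = n \<longrightarrow> L (tpure sA xs) = g xs)"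
proof -
  define h where "h = (\<lambda>xs. if length xs = n then g xs else 0)"
  interpret AV: vector_space_pair sA sV
    using A V by (rule vector_space_pair.intro)
  have h: "multilinear sA sV h"
    unfolding multilinear_def
  proof (intro allI)
    fix xs ys
    show "Vector_Spaces.linear sA sV (\<lambda>a. h (xs @ a # ys))"
      using g[of xs ys] AV.linear_0 AV.linear_zero by (cases "length xs + length ys + 1 = n") (simp_all add: h_def)
  qed
  have "\<exists>L. Vector_Spaces.linear fscale sV L \<and>
      (\<forall>xs. L (\<lambda>\<beta>. if multilinear sA (*) \<beta> then \<beta> xs else 0) = h xs)"
    by (rule evaluation_universal[OF V]) (rule multilinear_compose[OF h])
  then show ?thesis by (auto simp: tpure_def h_def)
qed

lemma tpow_unique:
  fixes sA :: "'k::field \<Rightarrow> 'a::ab_group_add \<Rightarrow> 'a"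
    and L L' :: "('a list, 'k) tensor \<Rightarrow> 'v::ab_group_add"
  assumes "Vector_Spaces.linear fscale sV L" "Vector_Spaces.linear fscale sV L'"
    and "\<And>xs. length xs = n \<Longrightarrow> L (tpure sA xs) = L' (tpure sA xs)" and "t \<in> tpow sA n"
  shows "L t = L' t"
proof -
  interpret vector_space_pair "fscale :: 'k \<Rightarrow> ('a list, 'k) tensor \<Rightarrow> _" sV
    using assms(1) unfolding Vector_Spaces.linear_iff by (blast intro: vector_space_pair.intro)
  show ?thesis
    using linear_eq_on[OF assms(1,2), of t "{tpure sA xs | xs. length xs = n}"] assms(3,4)
    by (auto simp: tpow_def)
qed

lemma tens2_universal:
  assumes V: "vector_space sV" and g: "bilinear sA sB sV g"
  shows "\<exists>L. Vector_Spaces.linear fscale sV L \<and> (\<forall>p. L (pure2 sA sB p) = g p)"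
  unfolding pure2_def by (rule evaluation_universal[OF V]) (rule bilinear_compose[OF g])

lemma tens2_unique:
  fixes sA :: "'k::field \<Rightarrow> 'a::ab_group_add \<Rightarrow> 'a" and sB :: "'k \<Rightarrow> 'b::ab_group_add \<Rightarrow> 'b"
    and L L' :: "('a \<times> 'b, 'k) tensor \<Rightarrow> 'v::ab_group_add"
  assumes "Vector_Spaces.linear fscale sV L" "Vector_Spaces.linear fscale sV L'"
    and "\<And>p. L (pure2 sA sB p) = L' (pure2 sA sB p)" and "t \<in> tens2 sA sB"
  shows "L t = L' t"
proof -
  interpret vector_space_pair "fscale :: 'k \<Rightarrow> ('a \<times> 'b, 'k) tensor \<Rightarrow> _" sV
    using assms(1) unfolding Vector_Spaces.linear_iff by (blast intro: vector_space_pair.intro)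
  show ?thesis
    by (rule linear_eq_on[OF assms(1,2), of t "range (pure2 sA sB)"])
      (use assms(3,4) in \<open>auto simp only: tens2_def\<close>)
qed

end

theory Submission
  imports Defs
begin

text \<open>
  Extend the families by zero beyond index \<open>N\<close> and let \<open>O\<^sub>X(m)\<close> and \<open>O\<^sub>F(m)\<close> be the coefficients of
  \<open>t\<^sup>m\<close> in \<open>(\<Delta>\<^sub>t \<otimes> Id)\<Delta>\<^sub>t - (Id \<otimes> \<Delta>\<^sub>t)\<Delta>\<^sub>t\<close> and \<open>(F\<^sub>t \<otimes> F\<^sub>t)\<Delta>\<^sub>A\<^sub>,\<^sub>t - \<Delta>\<^sub>B\<^sub>,\<^sub>t F\<^sub>t\<close>.
  They vanish for \<open>m \<le> N\<close> and are the obstructions for \<open>m = N + 1\<close>, so every term of the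
  differential of an obstruction, such as \<open>(Id \<otimes> O(N + 1))\<Delta>\<^sub>0\<close>, equals the full convolution
  \<open>\<Sum>\<^sub>i\<^sub>+\<^sub>j\<^sub>=\<^sub>N\<^sub>+\<^sub>1 (Id \<otimes> O(i))\<Delta>\<^sub>j\<close>. Expanding these sums over all tuples of indices, the terms cancel
  in pairs exactly as they would for a single comultiplication that is not assumed coassociative,
  the decisive point being \<open>(\<Delta> \<otimes> Id \<otimes> Id)(Id \<otimes> \<Delta>) = \<Delta> \<otimes> \<Delta> = (Id \<otimes> Id \<otimes> \<Delta>)(\<Delta> \<otimes> Id)\<close>.
\<close>

section \<open>Linear maps into tensor powers\<close>

text \<open>For positive \<open>n\<close> this is membership in \<open>coch\<close> together with
  \<open>vector_space sB\<close>. It is bundled so that one fact discharges every side condition of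
  the rules for \<open>tprod\<close> and \<open>tmap\<close>. Degree 0 is not forced to be
  zero.\<close>

definition tensor_map ::
  "('k::field \<Rightarrow> 'm::ab_group_add \<Rightarrow> 'm) \<Rightarrow> ('k \<Rightarrow> 'a::ab_group_add \<Rightarrow> 'a) \<Rightarrow> nat \<Rightarrow>
   ('m \<Rightarrow> ('a list, 'k) tensor) \<Rightarrow> bool" where
  "tensor_map sA sB n g \<longleftrightarrow>
     Vector_Spaces.linear sA fscale g \<and> vector_space sB \<and> (\<forall>x. g x \<in> tpow sB n)"

text \<open>The convolution product of \<open>g\<close> and \<open>h\<close>: comultiply by
  \<open>D\<close>, apply \<open>g\<close> and \<open>h\<close>, multiply in the tensor algebra. In
  this form (Id \<otimes> d) D is \<open>conv sA D (idt sA) d\<close>, so \<open>D\<close> is the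
  map that acts first.\<close>

definition conv ::
  "('k::field \<Rightarrow> 'b::ab_group_add \<Rightarrow> 'b) \<Rightarrow> ('m \<Rightarrow> ('a list, 'k) tensor) \<Rightarrow>
   ('a \<Rightarrow> ('b list, 'k) tensor) \<Rightarrow> ('a \<Rightarrow> ('b list, 'k) tensor) \<Rightarrow> 'm \<Rightarrow> ('b list, 'k) tensor" where
  "conv sB D g h = tmap sB [g, h] \<circ> D"

interpretation tensor: vector_space "fscale :: 'k::field \<Rightarrow> ('y \<Rightarrow> 'k) \<Rightarrow> _"
  by (rule vector_space_fscale)

lemma tpow_subset_span: "tpow sA n \<subseteq> tensor.span (range (tpure sA))"
  unfolding tpow_def by (rule tensor.span_mono) auto

lemma tpure_in_tpow: "length xs = n \<Longrightarrow> tpure sA xs \<in> tpow sA n"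
  unfolding tpow_def by (rule tensor.span_base) auto

lemma tpow_closed:
  "0 \<in> tpow sA n"
  "s \<in> tpow sA n \<Longrightarrow> t \<in> tpow sA n \<Longrightarrow> s + t \<in> tpow sA n"
  "s \<in> tpow sA n \<Longrightarrow> t \<in> tpow sA n \<Longrightarrow> s - t \<in> tpow sA n"
  "s \<in> tpow sA n \<Longrightarrow> fscale c s \<in> tpow sA n"
  unfolding tpow_def
  by (auto intro: tensor.span_zero tensor.span_add tensor.span_diff tensor.span_scale)

lemma linear_at_zero:
  assumes "Vector_Spaces.linear sV sW L"
  shows "L 0 = 0"
proof -
  have "L (0 + 0) = L 0 + L 0"
    using assms unfolding Vector_Spaces.linear_iff by blast
  then show ?thesis by simp
qed

lemma linear_preserves_tpow:
  assumes L: "Vector_Spaces.linear fscale fscale L"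
    and pure: "\<And>xs. length xs = n \<Longrightarrow> L (tpure sA xs) \<in> tpow sB m"
    and t: "t \<in> tpow sA n"
  shows "L t \<in> tpow sB m"
  using t unfolding tpow_def[of sA]
proof (induction rule: tensor.span_induct_alt)
  case base
  show ?case unfolding linear_at_zero[OF L] by (rule tpow_closed(1))
next
  case (step c x y)
  have "L (fscale c x + y) = fscale c (L x) + L y"
    using L by (simp add: Vector_Spaces.linear_iff)
  moreover have "L x \<in> tpow sB m"
    using step.hyps pure by blast
  ultimately show ?case
    using step.IH by (metis tpow_closed(2,4))
qed

section \<open>The tensor algebra: linearity, degree, unit and associativity of
  \<open>tprod\<close>\<close>

text \<open>An arbitrary functional \<open>s\<close> need not be additive, so linearity in the
  second argument is confined to spans of pure tensors. For a pure left factor \<open>tprod\<close>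
  is a \<open>lift\<close>, hence linear; linearity in the first argument then extends this to all
  \<open>s\<close> in the span.\<close>

lemma tprod_tpure_span_linear:
  fixes sA :: "'k::field \<Rightarrow> 'a::ab_group_add \<Rightarrow> 'a"
  assumes A: "vector_space sA"
    and t: "t \<in> tensor.span (range (tpure sA))" and u: "u \<in> tensor.span (range (tpure sA))"
    and s: "s \<in> tensor.span (range (tpure sA))"
  shows "tprod sA s (t + u) = tprod sA s t + tprod sA s u"
    and "tprod sA s (fscale c t) = fscale c (tprod sA s t)"
proof -
  have pure: "tprod sA (tpure sA xs) (t + u) = tprod sA (tpure sA xs) t + tprod sA (tpure sA xs) u"
    "tprod sA (tpure sA xs) (fscale c t) = fscale c (tprod sA (tpure sA xs) t)" for xs
    unfolding tprod_tpure_left[OF A t] tprod_tpure_left[OF A u]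
      tprod_tpure_left[OF A tensor.span_add[OF t u]] tprod_tpure_left[OF A tensor.span_scale[OF t]]
    by (simp_all add: lift_def fscale_def fun_eq_iff)
  have l: "tprod sA 0 v = 0" "tprod sA (x + y) v = tprod sA x v + tprod sA y v"
    "tprod sA (fscale d x) v = fscale d (tprod sA x v)" for v x y d
    by (simp_all add: tprod_def lift_def fscale_def fun_eq_iff)
  show "tprod sA s (t + u) = tprod sA s t + tprod sA s u"
    using s
  proof (induction rule: tensor.span_induct_alt)
    case base
    show ?case by (simp only: l tensor.scale_zero_right add_0_right)
  next
    case (step d x y)
    then show ?case by (auto simp only: l pure tensor.scale_right_distrib add_ac)
  qed
  show "tprod sA s (fscale c t) = fscale c (tprod sA s t)"
    using s
  proof (induction rule: tensor.span_induct_alt)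
    case base
    show ?case by (simp only: l tensor.scale_zero_right add_0_right)
  next
    case (step d x y)
    then show ?case by (auto simp only: l pure tensor.scale_right_distrib tensor.scale_scale mult.commute)
  qed
qed

lemma lift_tpure_append:
  assumes A: "vector_space sA"
  shows "lift (\<lambda>ys. tpure sA (xs @ ys)) (tpure sA zs) = tpure sA (xs @ zs)"
  using tprod_tpure_left[OF A tensor.span_base[OF rangeI], of xs zs] tprod_tpure[OF A, of xs zs] by simp

lemma tprod_add_left: "tprod sA (s + t) u = tprod sA s u + tprod sA t u"
  by (simp add: tprod_def lift_def fun_eq_iff)

lemma tprod_tpow:
  fixes sA :: "'k::field \<Rightarrow> 'a::ab_group_add \<Rightarrow> 'a"
  assumes A: "vector_space sA" and s: "s \<in> tpow sA p" and t: "t \<in> tpow sA q"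
  shows "tprod sA s t \<in> tpow sA (p + q)"
proof (rule linear_preserves_tpow[OF linear_tprod_left _ s])
  fix xs :: "'a list" assume xs: "length xs = p"
  have "lift (\<lambda>ys. tpure sA (xs @ ys)) t \<in> tpow sA (p + q)"
  proof (rule linear_preserves_tpow[OF linear_lift _ t])
    fix ys :: "'a list" assume "length ys = q"
    then show "lift (\<lambda>ys. tpure sA (xs @ ys)) (tpure sA ys) \<in> tpow sA (p + q)"
      using xs by (simp add: lift_tpure_append[OF A] tpure_in_tpow)
  qed
  then show "tprod sA (tpure sA xs) t \<in> tpow sA (p + q)"
    by (simp only: tprod_tpure_left[OF A subsetD[OF tpow_subset_span t]])
qed

text \<open>The \<open>foldr\<close> in \<open>tmap\<close> ends in \<open>tpure sB []\<close>; this
  unit law removes that last factor.\<close>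

lemma tprod_Nil_right:
  fixes sA :: "'k::field \<Rightarrow> 'a::ab_group_add \<Rightarrow> 'a"
  assumes A: "vector_space sA" and s: "s \<in> tpow sA n"
  shows "tprod sA s (tpure sA []) = s"
proof (rule tpow_unique[where L = "\<lambda>s. tprod sA s (tpure sA [])" and L' = "\<lambda>s. s", OF linear_tprod_left _ _ s])
  show "Vector_Spaces.linear fscale fscale (\<lambda>s :: ('a list, 'k) tensor. s)"
    by (rule tensor.linear_ident)
qed (simp only: tprod_tpure[OF A] append_Nil2)

lemma linear_tprod_left_comp:
  fixes sB :: "'k::field \<Rightarrow> 'b::ab_group_add \<Rightarrow> 'b"
  assumes "Vector_Spaces.linear sV fscale R"
  shows "Vector_Spaces.linear sV fscale (\<lambda>v. tprod sB (R v) t)"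
  using Vector_Spaces.linear_compose[OF assms linear_tprod_left] by (simp add: comp_def)

text \<open>On pure tensors both sides concatenate words. The three arguments are reduced to pure
  tensors one after the other, from left to right.\<close>

lemma tprod_assoc:
  fixes sA :: "'k::field \<Rightarrow> 'a::ab_group_add \<Rightarrow> 'a"
  assumes A: "vector_space sA" and s: "s \<in> tpow sA p" and t: "t \<in> tpow sA q" and u: "u \<in> tpow sA r"
  shows "tprod sA (tprod sA s t) u = tprod sA s (tprod sA t u)"
proof (rule tpow_unique[OF _ linear_tprod_left _ s])
  show "Vector_Spaces.linear fscale fscale (\<lambda>s. tprod sA (tprod sA s t) u)"
    by (rule linear_tprod_left_comp) (rule linear_tprod_left)
  have lift_t: "tprod sA (tpure sA xs) v = lift (\<lambda>ys. tpure sA (xs @ ys)) v"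
    if "v \<in> tpow sA n" for xs v n
    using tprod_tpure_left[OF A] tpow_subset_span that by blast
  fix xs :: "'a list"
  \<comment> \<open>The pure left factor is rewritten as a \<open>lift\<close>, because
    \<open>tpow_unique\<close> asks for maps that are linear on all functionals.\<close>
  have "tprod sA (lift (\<lambda>ys. tpure sA (xs @ ys)) t) u = lift (\<lambda>ys. tpure sA (xs @ ys)) (tprod sA t u)"
  proof (rule tpow_unique[OF _ _ _ t])
    show "Vector_Spaces.linear fscale fscale (\<lambda>t. tprod sA (lift (\<lambda>ys. tpure sA (xs @ ys)) t) u)"
      by (rule linear_tprod_left_comp) (rule linear_lift)
    show "Vector_Spaces.linear fscale fscale (\<lambda>t. lift (\<lambda>ys. tpure sA (xs @ ys)) (tprod sA t u))"
      using Vector_Spaces.linear_compose[OF linear_tprod_left linear_lift] by (simp add: comp_def)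
    fix ys :: "'a list"
    have "lift (\<lambda>zs. tpure sA ((xs @ ys) @ zs)) u
      = lift (\<lambda>zs. tpure sA (xs @ zs)) (lift (\<lambda>zs. tpure sA (ys @ zs)) u)"
    proof (rule tpow_unique[OF linear_lift _ _ u])
      show "Vector_Spaces.linear fscale fscale
        (\<lambda>u. lift (\<lambda>zs. tpure sA (xs @ zs)) (lift (\<lambda>zs. tpure sA (ys @ zs)) u))"
        using Vector_Spaces.linear_compose[OF linear_lift linear_lift] by (simp add: comp_def)
    qed (simp only: lift_tpure_append[OF A] flip: append_assoc)
    then show "tprod sA (lift (\<lambda>ys. tpure sA (xs @ ys)) (tpure sA ys)) u
      = lift (\<lambda>ys. tpure sA (xs @ ys)) (tprod sA (tpure sA ys) u)"
      by (simp only: lift_tpure_append[OF A] lift_t[OF u])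
  qed
  then show "tprod sA (tprod sA (tpure sA xs) t) u = tprod sA (tpure sA xs) (tprod sA t u)"
    by (simp only: lift_t[OF t] lift_t[OF tprod_tpow[OF A t u]])
qed

section \<open>Tensor products of two and three maps on low tensor powers\<close>

lemma tensor_mapD:
  assumes "tensor_map sA sB n g"
  shows "vector_space sA" "vector_space sB" "Vector_Spaces.linear sA fscale g" "g x \<in> tpow sB n"
    "g x \<in> tensor.span (range (tpure sB))"
  using assms subsetD[OF tpow_subset_span, of "g x" sB n]
  by (auto simp: tensor_map_def Vector_Spaces.linear_iff)

lemma tmap_tpure2:
  assumes g: "tensor_map sA sB p g" and h: "tensor_map sA sB q h"
  shows "tmap sB [g, h] (tpure sA [x, y]) = tprod sB (g x) (h y)"
proof -
  have "tmap sB [g, h] (tpure sA [x, y]) = foldr (tprod sB) (map2 (\<lambda>g x. g x) [g, h] [x, y]) (tpure sB [])"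
    by (rule tmap_tpure) (use tensor_mapD[OF g] tensor_mapD[OF h] in auto)
  then show ?thesis
    using tprod_Nil_right[OF tensor_mapD(2)[OF h] tensor_mapD(4)[OF h]] by simp
qed

lemma tmap_tpure3:
  assumes g: "tensor_map sA sB p g" and h: "tensor_map sA sB q h" and k: "tensor_map sA sB r k"
  shows "tmap sB [g, h, k] (tpure sA [x, y, z]) = tprod sB (g x) (tprod sB (h y) (k z))"
proof -
  have "tmap sB [g, h, k] (tpure sA [x, y, z])
    = foldr (tprod sB) (map2 (\<lambda>g x. g x) [g, h, k] [x, y, z]) (tpure sB [])"
    by (rule tmap_tpure) (use tensor_mapD[OF g] tensor_mapD[OF h] tensor_mapD[OF k] in auto)
  then show ?thesis
    using tprod_Nil_right[OF tensor_mapD(2)[OF k] tensor_mapD(4)[OF k]] by simp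
qed

lemma linear_tmap: "Vector_Spaces.linear fscale fscale (tmap sB gs)"
  unfolding tmap_def by (rule linear_lift)

lemma length2E: "length xs = 2 \<Longrightarrow> \<exists>x y. xs = [x, y]"
  by (metis length_0_conv length_Suc_conv numeral_2_eq_2)

lemma tpow2_unique:
  assumes "Vector_Spaces.linear fscale fscale L" "Vector_Spaces.linear fscale fscale L'"
    and "\<And>x y. L (tpure sA [x, y]) = L' (tpure sA [x, y])" "t \<in> tpow sA 2"
  shows "L t = L' t"
  by (rule tpow_unique[OF assms(1,2) _ assms(4)]) (auto dest!: length2E simp: assms(3))

lemma tmap_tpow2:
  assumes g: "tensor_map sA sB p g" and h: "tensor_map sA sB q h" and t: "t \<in> tpow sA 2"
  shows "tmap sB [g, h] t \<in> tpow sB (p + q)"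
  by (rule linear_preserves_tpow[OF linear_tmap _ t])
    (auto dest!: length2E simp: tmap_tpure2[OF g h]
      intro!: tprod_tpow tensor_mapD[OF g] tensor_mapD[OF h])

lemma tensor_map_conv:
  assumes D: "tensor_map sM sA 2 D" and g: "tensor_map sA sB p g" and h: "tensor_map sA sB q h"
  shows "tensor_map sM sB (p + q) (conv sB D g h)"
  unfolding tensor_map_def conv_def
  using Vector_Spaces.linear_compose[OF tensor_mapD(3)[OF D] linear_tmap] tensor_mapD[OF g]
    tmap_tpow2[OF g h] tensor_mapD(4)[OF D] by auto

lemma tensor_map_idt: "vector_space sA \<Longrightarrow> tensor_map sA sA 1 (idt sA)"
  using multilinear_tpure[of sA] unfolding multilinear_def tensor_map_def idt_def
  by (auto intro: tpure_in_tpow dest: spec[of _ "[]"])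

lemma tensor_map_comp:
  assumes "tensor_map sB sC n g" "Vector_Spaces.linear sA sB f"
  shows "tensor_map sA sC n (g \<circ> f)"
  using assms Vector_Spaces.linear_compose[OF assms(2)] by (auto simp: tensor_map_def)

text \<open>Both sides are linear in \<open>t\<close> on all functionals, so the words
  \<open>[x, y]\<close> decide. There the claim is associativity of \<open>tprod\<close>.\<close>

lemma tmap3_tprod_left:
  assumes g: "tensor_map sA sB p g" and h: "tensor_map sA sB q h" and k: "tensor_map sA sB r k"
    and t: "t \<in> tpow sA 2"
  shows "tmap sB [g, h, k] (tprod sA t (tpure sA [z])) = tprod sB (tmap sB [g, h] t) (k z)"
proof (rule tpow2_unique[OF _ _ _ t])
  show "Vector_Spaces.linear fscale fscale (\<lambda>t. tmap sB [g, h, k] (tprod sA t (tpure sA [z])))"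
    using Vector_Spaces.linear_compose[OF linear_tprod_left linear_tmap] by (simp add: comp_def)
  show "Vector_Spaces.linear fscale fscale (\<lambda>t. tprod sB (tmap sB [g, h] t) (k z))"
    by (rule linear_tprod_left_comp) (rule linear_tmap)
qed (simp add: tprod_tpure tmap_tpure2[OF g h] tmap_tpure3[OF g h k]
    tprod_assoc[OF tensor_mapD(2)[OF g] tensor_mapD(4)[OF g] tensor_mapD(4)[OF h] tensor_mapD(4)[OF k]]
    tensor_mapD(1)[OF g])

text \<open>Here \<open>t\<close> enters the right-hand side through the second argument of
  \<open>tprod\<close>, where linearity is known only on the span. An induction over the span
  therefore replaces the appeal to \<open>tpow2_unique\<close>.\<close>

lemma tmap3_tprod_right:
  fixes sA :: "'k::field \<Rightarrow> 'a::ab_group_add \<Rightarrow> 'a"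
  assumes g: "tensor_map sA sB p g" and h: "tensor_map sA sB q h" and k: "tensor_map sA sB r k"
    and t: "t \<in> tpow sA 2"
  shows "tmap sB [g, h, k] (tprod sA (tpure sA [x]) t) = tprod sB (g x) (tmap sB [h, k] t)"
proof -
  note A = tensor_mapD(1)[OF g] and B = tensor_mapD(2)[OF g]
  have *: "tprod sA (tpure sA [x]) u = lift (\<lambda>ys. tpure sA ([x] @ ys)) u" if "u \<in> tpow sA 2" for u
    using tprod_tpure_left[OF A] tpow_subset_span that by blast
  let ?L = "\<lambda>t. tmap sB [g, h, k] (lift (\<lambda>ys. tpure sA ([x] @ ys)) t)"
  have L: "Vector_Spaces.linear fscale fscale ?L"
    using Vector_Spaces.linear_compose[OF linear_lift linear_tmap] by (simp add: comp_def)
  have pure: "?L (tpure sA [y, z]) = tprod sB (g x) (tmap sB [h, k] (tpure sA [y, z]))" for y z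
    unfolding lift_tpure_append[OF A] by (simp add: tmap_tpure2[OF h k] tmap_tpure3[OF g h k])
  \<comment> \<open>Membership in the span is part of the induction claim, since splitting
    \<open>tprod\<close> over a sum in its second argument requires it of both summands.\<close>
  have "tmap sB [h, k] t \<in> tensor.span (range (tpure sB)) \<and> ?L t = tprod sB (g x) (tmap sB [h, k] t)"
    using t unfolding tpow_def
  proof (induction rule: tensor.span_induct_alt)
    case base
    have "tprod sB (g x) 0 = 0"
      using tprod_tpure_span_linear(1)[OF B tensor.span_zero tensor.span_zero tensor_mapD(5)[OF g]]
      by (simp only: add_0_right add_cancel_right_right)
    then show ?case
      by (simp only: linear_at_zero[OF L] linear_at_zero[OF linear_tmap] tensor.span_zero)
  next
    case (step c u v)
    have "tmap sB [h, k] u \<in> tensor.span (range (tpure sB))"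
      using tmap_tpow2[OF h k] tpow_subset_span step.hyps tpure_in_tpow by blast
    moreover have "?L u = tprod sB (g x) (tmap sB [h, k] u)"
      using step.hyps pure by (auto dest!: length2E)
    moreover have "?L (fscale c u + v) = fscale c (?L u) + ?L v"
      using L unfolding Vector_Spaces.linear_iff by simp
    moreover have "tmap sB [h, k] (fscale c u + v) = fscale c (tmap sB [h, k] u) + tmap sB [h, k] v"
      using linear_tmap[of sB "[h, k]"] unfolding Vector_Spaces.linear_iff by simp
    ultimately show ?case
      using step.IH by (simp only: tensor.span_scale tensor.span_add
        tprod_tpure_span_linear[OF B _ _ tensor_mapD(5)[OF g]] simp_thms)
  qed
  then show ?thesis by (simp only: *[OF t])
qed

section \<open>The convolution product\<close>

lemma tensor_map_zero: "vector_space sA \<Longrightarrow> vector_space sB \<Longrightarrow> tensor_map sA sB n 0"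
  by (auto simp: tensor_map_def Vector_Spaces.linear_iff vector_space_fscale tpow_closed(1))

lemma tensor_map_add:
  assumes "tensor_map sA sB n g" "tensor_map sA sB n h"
  shows "tensor_map sA sB n (g + h)"
  using assms
  by (auto simp: tensor_map_def Vector_Spaces.linear_iff tpow_closed(2)
      tensor.scale_right_distrib algebra_simps simp del: plus_fun_def)

lemma tensor_map_diff:
  assumes "tensor_map sA sB n g" "tensor_map sA sB n h"
  shows "tensor_map sA sB n (g - h)"
  using assms
  by (auto simp: tensor_map_def Vector_Spaces.linear_iff tpow_closed(3)
      tensor.scale_right_diff_distrib algebra_simps)

lemma tensor_map_sum:
  assumes "vector_space sA" "vector_space sB" "\<And>i. i \<in> S \<Longrightarrow> tensor_map sA sB n (g i)"
  shows "tensor_map sA sB n (\<Sum>i\<in>S. g i)"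
  using assms(3)
proof (induction S rule: infinite_finite_induct)
  case (insert i S)
  then show ?case
    unfolding sum.insert[OF insert.hyps] by (intro tensor_map_add) auto
qed (simp_all only: sum.infinite sum.empty tensor_map_zero[OF assms(1,2)] not_False_eq_True)

lemma tmap_comp_add: "tmap sB gs \<circ> (u + v) = (tmap sB gs \<circ> u) + (tmap sB gs \<circ> v)"
  by (auto simp: fun_eq_iff tmap_def lift_def)

lemma tmap_comp_diff: "tmap sB gs \<circ> (u - v) = (tmap sB gs \<circ> u) - (tmap sB gs \<circ> v)"
  by (auto simp: fun_eq_iff tmap_def lift_def)

lemma tmap_comp_zero: "tmap sB gs \<circ> 0 = 0"
  by (auto simp: fun_eq_iff tmap_def lift_def)

lemma tmap_comp_sum: "tmap sB gs \<circ> (\<Sum>i\<in>S. u i) = (\<Sum>i\<in>S. tmap sB gs \<circ> u i)"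
  by (induction S rule: infinite_finite_induct)
    (simp_all only: sum.infinite sum.empty sum.insert tmap_comp_zero tmap_comp_add not_False_eq_True)

text \<open>Needed to compare one \<open>tmap\<close> with a sum of two in the proofs that
  \<open>conv\<close> is biadditive.\<close>

lemma linear_tmap_add:
  "Vector_Spaces.linear fscale fscale (tmap sB gs + tmap sB hs)"
  using linear_tmap[of sB gs] linear_tmap[of sB hs]
  by (simp add: Vector_Spaces.linear_iff tensor.scale_right_distrib add_ac)

lemma comp_add_left: "(u + v) \<circ> h = (u \<circ> h) + (v \<circ> h)"
  and comp_diff_left: "(u - v) \<circ> h = (u \<circ> h) - (v \<circ> h)"
  and comp_zero_left: "0 \<circ> h = 0"
  by (auto simp: fun_eq_iff)

lemma comp_sum_left:
  fixes u :: "'i \<Rightarrow> 'b \<Rightarrow> 'c::ab_group_add"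
  shows "(\<Sum>i\<in>S. u i) \<circ> h = (\<Sum>i\<in>S. u i \<circ> h)"
proof (induction S rule: infinite_finite_induct)
  case (insert i S)
  then show ?case unfolding sum.insert[OF insert.hyps] comp_add_left by (simp only:)
qed (simp_all only: sum.infinite sum.empty comp_zero_left not_False_eq_True)

context
  fixes sM :: "'k::field \<Rightarrow> 'm::ab_group_add \<Rightarrow> 'm" and sA :: "'k \<Rightarrow> 'a::ab_group_add \<Rightarrow> 'a"
    and sB :: "'k \<Rightarrow> 'b::ab_group_add \<Rightarrow> 'b" and D
  assumes D: "tensor_map sM sA 2 D"
begin

text \<open>All values of \<open>D\<close> lie in the second tensor power, where words of length two
  determine a linear map.\<close>

lemma conv_eqI:
  assumes "Vector_Spaces.linear fscale fscale L" "Vector_Spaces.linear fscale fscale L'"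
    and "\<And>x y. L (tpure sA [x, y]) = L' (tpure sA [x, y])"
  shows "L \<circ> D = L' \<circ> D"
  using tpow2_unique[OF assms tensor_mapD(4)[OF D]] by (simp add: fun_eq_iff)

lemma conv_add_left:
  assumes g: "tensor_map sA sB p g" and g': "tensor_map sA sB p g'" and h: "tensor_map sA sB q h"
  shows "conv sB D (g + g') h = conv sB D g h + conv sB D g' h"
  unfolding conv_def comp_add_left[symmetric]
  by (rule conv_eqI[OF linear_tmap linear_tmap_add])
    (simp add: tmap_tpure2[OF tensor_map_add[OF g g'] h] tmap_tpure2[OF g h] tmap_tpure2[OF g' h]
      tprod_add_left)

lemma conv_add_right:
  assumes g: "tensor_map sA sB p g" and h: "tensor_map sA sB q h" and h': "tensor_map sA sB q h'"
  shows "conv sB D g (h + h') = conv sB D g h + conv sB D g h'"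
  unfolding conv_def comp_add_left[symmetric]
  by (rule conv_eqI[OF linear_tmap linear_tmap_add])
    (simp add: tmap_tpure2[OF g tensor_map_add[OF h h']] tmap_tpure2[OF g h] tmap_tpure2[OF g h']
      tprod_tpure_span_linear(1)[OF tensor_mapD(2)[OF g] tensor_mapD(5)[OF h] tensor_mapD(5)[OF h'] tensor_mapD(5)[OF g]])

lemma conv_diff_left:
  assumes g: "tensor_map sA sB p g" and g': "tensor_map sA sB p g'" and h: "tensor_map sA sB q h"
  shows "conv sB D (g - g') h = conv sB D g h - conv sB D g' h"
  using conv_add_left[OF tensor_map_diff[OF g g'] g' h] by (simp only: diff_add_cancel eq_diff_eq)

lemma conv_diff_right:
  assumes g: "tensor_map sA sB p g" and h: "tensor_map sA sB q h" and h': "tensor_map sA sB q h'"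
  shows "conv sB D g (h - h') = conv sB D g h - conv sB D g h'"
  using conv_add_right[OF g tensor_map_diff[OF h h'] h'] by (simp only: diff_add_cancel eq_diff_eq)

lemma conv_zero_left: "tensor_map sA sB q h \<Longrightarrow> conv sB D 0 h = 0"
  using conv_diff_left[of 0 0 0 q h] tensor_map_zero tensor_mapD(1,2)[of sA sB q h]
  by (metis cancel_comm_monoid_add_class.diff_cancel)

lemma conv_zero_right: "tensor_map sA sB p g \<Longrightarrow> conv sB D g 0 = 0"
  using conv_diff_right[of p g 0 0 0] tensor_map_zero tensor_mapD(1,2)[of sA sB p g]
  by (metis cancel_comm_monoid_add_class.diff_cancel)

lemma conv_sum_left:
  assumes h: "tensor_map sA sB q h" and g: "\<And>i. i \<in> S \<Longrightarrow> tensor_map sA sB p (g i)"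
  shows "conv sB D (\<Sum>i\<in>S. g i) h = (\<Sum>i\<in>S. conv sB D (g i) h)"
  using g
proof (induction S rule: infinite_finite_induct)
  case (insert i S)
  have "tensor_map sA sB p (\<Sum>i\<in>S. g i)"
    by (rule tensor_map_sum[OF tensor_mapD(1,2)[OF h]]) (rule insert.prems, rule insertI2)
  with insert show ?case
    using conv_add_left[of p "g i" "\<Sum>i\<in>S. g i" q h, OF _ _ h]
    by (simp only: sum.insert insertI1 insertI2 not_False_eq_True)
qed (simp_all only: sum.infinite sum.empty conv_zero_left[OF h] not_False_eq_True)

lemma conv_sum_right:
  assumes g: "tensor_map sA sB p g" and h: "\<And>i. i \<in> S \<Longrightarrow> tensor_map sA sB q (h i)"
  shows "conv sB D g (\<Sum>i\<in>S. h i) = (\<Sum>i\<in>S. conv sB D g (h i))"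
  using h
proof (induction S rule: infinite_finite_induct)
  case (insert i S)
  have "tensor_map sA sB q (\<Sum>i\<in>S. h i)"
    by (rule tensor_map_sum[OF tensor_mapD(1,2)[OF g]]) (rule insert.prems, rule insertI2)
  with insert show ?case
    using conv_add_right[of p g q "h i" "\<Sum>i\<in>S. h i", OF g]
    by (simp only: sum.insert insertI1 insertI2 not_False_eq_True)
qed (simp_all only: sum.infinite sum.empty conv_zero_right[OF g] not_False_eq_True)

text \<open>Concatenating two words of length one gives back the pure tensor. Used with an inner
  comultiplication in place of \<open>D\<close>, this turns both (d \<otimes> Id \<otimes> Id)(Id
  \<otimes> d') and (Id \<otimes> Id \<otimes> d')(d \<otimes> Id) into d \<otimes> d'.\<close>

lemma conv_idt_idt: "conv sA D (idt sA) (idt sA) = D"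
proof -
  have A: "vector_space sA" by (rule tensor_mapD(2)[OF D])
  have "tmap sA [idt sA, idt sA] \<circ> D = (\<lambda>t. t) \<circ> D"
    by (rule conv_eqI[OF linear_tmap tensor.linear_ident])
      (simp add: tmap_tpure2[OF tensor_map_idt[OF A] tensor_map_idt[OF A]] idt_def tprod_tpure[OF A])
  then show ?thesis by (simp add: conv_def comp_def)
qed

section \<open>Composites of tensor maps with convolutions\<close>

text \<open>On a pure tensor the identity leaves \<open>x\<close> as a separate left factor, which
  \<open>g\<close> takes; \<open>h\<close> and \<open>k\<close> share the two factors produced by
  \<open>d\<close>. Together with its mirror image below, this expands every three-fold tensor map
  applied to a coassociativity defect.\<close>

lemma tmap3_conv_idt_left:
  assumes d: "tensor_map sA sA 2 d"
    and g: "tensor_map sA sB p g" and h: "tensor_map sA sB q h" and k: "tensor_map sA sB r k"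
  shows "tmap sB [g, h, k] \<circ> conv sA D (idt sA) d = conv sB D g (conv sB d h k)"
  unfolding conv_def[of _ D] comp_assoc[symmetric]
proof (rule conv_eqI)
  show "Vector_Spaces.linear fscale fscale (tmap sB [g, h, k] \<circ> tmap sA [idt sA, d])"
    by (rule Vector_Spaces.linear_compose[OF linear_tmap linear_tmap])
  show "Vector_Spaces.linear fscale fscale (tmap sB [g, conv sB d h k])"
    by (rule linear_tmap)
  show "(tmap sB [g, h, k] \<circ> tmap sA [idt sA, d]) (tpure sA [x, y])
      = tmap sB [g, conv sB d h k] (tpure sA [x, y])" for x y
    by (simp add: tmap_tpure2[OF tensor_map_idt[OF tensor_mapD(1)[OF g]] d] tmap_tpure2[OF g tensor_map_conv[OF d h k]])
      (simp add: idt_def tmap3_tprod_right[OF g h k tensor_mapD(4)[OF d]] conv_def)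
qed

lemma tmap3_conv_idt_right:
  assumes d: "tensor_map sA sA 2 d"
    and g: "tensor_map sA sB p g" and h: "tensor_map sA sB q h" and k: "tensor_map sA sB r k"
  shows "tmap sB [g, h, k] \<circ> conv sA D d (idt sA) = conv sB D (conv sB d g h) k"
  unfolding conv_def[of _ D] comp_assoc[symmetric]
proof (rule conv_eqI)
  show "Vector_Spaces.linear fscale fscale (tmap sB [g, h, k] \<circ> tmap sA [d, idt sA])"
    by (rule Vector_Spaces.linear_compose[OF linear_tmap linear_tmap])
  show "Vector_Spaces.linear fscale fscale (tmap sB [conv sB d g h, k])"
    by (rule linear_tmap)
  show "(tmap sB [g, h, k] \<circ> tmap sA [d, idt sA]) (tpure sA [x, y])
      = tmap sB [conv sB d g h, k] (tpure sA [x, y])" for x y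
    by (simp add: tmap_tpure2[OF d tensor_map_idt[OF tensor_mapD(1)[OF g]]] tmap_tpure2[OF tensor_map_conv[OF d g h] k])
      (simp add: idt_def tmap3_tprod_left[OF g h k tensor_mapD(4)[OF d]] conv_def)
qed

text \<open>Functoriality of the tensor product: (g \<otimes> h)(\<phi> \<otimes> \<psi>) = g\<phi>
  \<otimes> h\<psi>. The identifications \<open>idt sB\<close> are absorbed because \<open>g\<close>
  and \<open>h\<close> then act on words of length one.\<close>

lemma tmap2_conv_linear:
  assumes \<phi>: "Vector_Spaces.linear sA sB \<phi>" and \<psi>: "Vector_Spaces.linear sA sB \<psi>"
    and g: "tensor_map sB sC p g" and h: "tensor_map sB sC q h"
  shows "tmap sC [g, h] \<circ> conv sB D (idt sB \<circ> \<phi>) (idt sB \<circ> \<psi>) = conv sC D (g \<circ> \<phi>) (h \<circ> \<psi>)"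
  unfolding conv_def comp_assoc[symmetric]
proof (rule conv_eqI)
  note B = tensor_mapD(1)[OF g]
  note i = tensor_map_comp[OF tensor_map_idt[OF B]]
  show "Vector_Spaces.linear fscale fscale (tmap sC [g, h] \<circ> tmap sB [idt sB \<circ> \<phi>, idt sB \<circ> \<psi>])"
    by (rule Vector_Spaces.linear_compose[OF linear_tmap linear_tmap])
  show "Vector_Spaces.linear fscale fscale (tmap sC [g \<circ> \<phi>, h \<circ> \<psi>])"
    by (rule linear_tmap)
  show "(tmap sC [g, h] \<circ> tmap sB [idt sB \<circ> \<phi>, idt sB \<circ> \<psi>]) (tpure sA [x, y])
      = tmap sC [g \<circ> \<phi>, h \<circ> \<psi>] (tpure sA [x, y])" for x y
    by (simp add: tmap_tpure2[OF i[OF \<phi>] i[OF \<psi>]]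
        tmap_tpure2[OF tensor_map_comp[OF g \<phi>] tensor_map_comp[OF h \<psi>]])
      (simp add: idt_def tprod_tpure[OF B] tmap_tpure2[OF g h])
qed

text \<open>Identifies the left coaction term of \<open>coch_diff\<close> with a convolution. The
  map under \<open>lift\<close> is bilinear, so \<open>lift\<close> may be evaluated on pure
  tensors.\<close>

lemma lift_map2t_left:
  assumes \<phi>: "Vector_Spaces.linear sA sB \<phi>" and \<sigma>: "tensor_map sA sB n \<sigma>"
  shows "lift (\<lambda>(b, x). tprod sB (idt sB b) (\<sigma> x)) \<circ> (map2t sB sA \<phi> id \<circ> D)
    = conv sB D (idt sB \<circ> \<phi>) \<sigma>"
  unfolding conv_def comp_assoc[symmetric]
proof (rule conv_eqI)
  note A = tensor_mapD(1)[OF \<sigma>] and B = tensor_mapD(2)[OF \<sigma>]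
  show "Vector_Spaces.linear fscale fscale
      (lift (\<lambda>(b, x). tprod sB (idt sB b) (\<sigma> x)) \<circ> map2t sB sA \<phi> id)"
    unfolding map2t_def by (rule Vector_Spaces.linear_compose[OF linear_lift linear_lift])
  show "Vector_Spaces.linear fscale fscale (tmap sB [idt sB \<circ> \<phi>, \<sigma>])"
    by (rule linear_tmap)
  have bil: "bilinear sB sA fscale (\<lambda>(b, x). tprod sB (idt sB b) (\<sigma> x))"
    unfolding bilinear_def split
    using linear_tprod_left_comp[OF tensor_mapD(3)[OF tensor_map_idt[OF B]]]
      linear_tprod_right[OF B tensor_mapD(5)[OF tensor_map_idt[OF B]] tensor_mapD(3,5)[OF \<sigma>]]
    by blast
  have id: "Vector_Spaces.linear sA sA id" using A by (simp add: Vector_Spaces.linear_iff)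
  show "(lift (\<lambda>(b, x). tprod sB (idt sB b) (\<sigma> x)) \<circ> map2t sB sA \<phi> id) (tpure sA [x, y])
      = tmap sB [idt sB \<circ> \<phi>, \<sigma>] (tpure sA [x, y])" for x y
    by (simp add: map2t_tpure[OF \<phi> id] lift_pure2[OF bil]
        tmap_tpure2[OF tensor_map_comp[OF tensor_map_idt[OF B] \<phi>] \<sigma>])
qed

lemma lift_map2t_right:
  assumes \<phi>: "Vector_Spaces.linear sA sB \<phi>" and \<sigma>: "tensor_map sA sB n \<sigma>"
  shows "lift (\<lambda>(x, b). tprod sB (\<sigma> x) (idt sB b)) \<circ> (map2t sA sB id \<phi> \<circ> D)
    = conv sB D \<sigma> (idt sB \<circ> \<phi>)"
  unfolding conv_def comp_assoc[symmetric]
proof (rule conv_eqI)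
  note A = tensor_mapD(1)[OF \<sigma>] and B = tensor_mapD(2)[OF \<sigma>]
  show "Vector_Spaces.linear fscale fscale
      (lift (\<lambda>(x, b). tprod sB (\<sigma> x) (idt sB b)) \<circ> map2t sA sB id \<phi>)"
    unfolding map2t_def by (rule Vector_Spaces.linear_compose[OF linear_lift linear_lift])
  show "Vector_Spaces.linear fscale fscale (tmap sB [\<sigma>, idt sB \<circ> \<phi>])"
    by (rule linear_tmap)
  have bil: "bilinear sA sB fscale (\<lambda>(x, b). tprod sB (\<sigma> x) (idt sB b))"
    unfolding bilinear_def split
    using linear_tprod_left_comp[OF tensor_mapD(3)[OF \<sigma>]]
      linear_tprod_right[OF B tensor_mapD(5)[OF \<sigma>] tensor_mapD(3,5)[OF tensor_map_idt[OF B]]]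
    by blast
  have id: "Vector_Spaces.linear sA sA id" using A by (simp add: Vector_Spaces.linear_iff)
  show "(lift (\<lambda>(x, b). tprod sB (\<sigma> x) (idt sB b)) \<circ> map2t sA sB id \<phi>) (tpure sA [x, y])
      = tmap sB [\<sigma>, idt sB \<circ> \<phi>] (tpure sA [x, y])" for x y
    by (simp add: map2t_tpure[OF id \<phi>] lift_pure2[OF bil]
        tmap_tpure2[OF \<sigma> tensor_map_comp[OF tensor_map_idt[OF B] \<phi>]])
qed

end

section \<open>The Hochschild differentials in the two degrees that occur\<close>

text \<open>The bicomodule terms are convolutions with the identity, by the two preceding lemmas at
  \<open>id\<close>. The last sign is (-1)^4 = 1.\<close>

lemma diff_self_3:
  assumes D: "tensor_map sA sA 2 D" and \<sigma>: "tensor_map sA sA n \<sigma>"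
  shows "diff_self sA D 3 \<sigma> = conv sA D (idt sA) \<sigma> - (tmap sA [D, idt sA, idt sA] \<circ> \<sigma>)
    + (tmap sA [idt sA, D, idt sA] \<circ> \<sigma>) - (tmap sA [idt sA, idt sA, D] \<circ> \<sigma>) + conv sA D \<sigma> (idt sA)"
proof -
  have id: "Vector_Spaces.linear sA sA id"
    using tensor_mapD(1)[OF D] by (simp add: Vector_Spaces.linear_iff)
  have "{1..3::nat} = {1, 2, 3}" by auto
  then show ?thesis
    using fun_cong[OF lift_map2t_left[OF D id \<sigma>]] fun_cong[OF lift_map2t_right[OF D id \<sigma>]]
    by (simp add: diff_self_def coch_diff_def fun_eq_iff fscale_def numeral_2_eq_2 numeral_3_eq_3)
qed

text \<open>The third component of a 3-cochain of the deformation complex has degree 2, so the last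
  sign is (-1)^3 = -1.\<close>

lemma diff_mor_2:
  assumes DA: "tensor_map sA sA 2 DA" and f: "Vector_Spaces.linear sA sB f" and \<sigma>: "tensor_map sA sB n \<sigma>"
  shows "diff_mor sA DA sB DB f 2 \<sigma> = conv sB DA (idt sB \<circ> f) \<sigma> - (tmap sB [DB, idt sB] \<circ> \<sigma>)
    + (tmap sB [idt sB, DB] \<circ> \<sigma>) - conv sB DA \<sigma> (idt sB \<circ> f)"
proof -
  have "{1..2::nat} = {1, 2}" by auto
  then show ?thesis
    using fun_cong[OF lift_map2t_left[OF DA f \<sigma>]] fun_cong[OF lift_map2t_right[OF DA f \<sigma>]]
    by (simp add: diff_mor_def coch_diff_def fun_eq_iff fscale_def numeral_2_eq_2)
qed

section \<open>Reindexing of convolution sums\<close>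

text \<open>The single indices carry no bound by \<open>N\<close>: the families will be extended by
  zero instead, which keeps the index sets symmetric and easy to reindex.\<close>

definition idx2 :: "nat \<Rightarrow> (nat \<times> nat) set" where
  "idx2 m = {(i, j). i + j = m}"

definition idx3 :: "nat \<Rightarrow> (nat \<times> nat \<times> nat) set" where
  "idx3 m = {(i, j, k). i + j + k = m}"

definition idx4 :: "nat \<Rightarrow> (nat \<times> nat \<times> nat \<times> nat) set" where
  "idx4 m = {(i, j, k, l). i + j + k + l = m}"

definition idx5 :: "nat \<Rightarrow> (nat \<times> nat \<times> nat \<times> nat \<times> nat) set" where
  "idx5 m = {(i, j, k, l, n). i + j + k + l + n = m}"

lemma finite_idx: "finite (idx2 m)" "finite (idx3 m)" "finite (idx4 m)" "finite (idx5 m)"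
proof -
  show "finite (idx2 m)"
    by (rule finite_subset[of _ "{..m} \<times> {..m}"]) (auto simp: idx2_def)
  show "finite (idx3 m)"
    by (rule finite_subset[of _ "{..m} \<times> {..m} \<times> {..m}"]) (auto simp: idx3_def)
  show "finite (idx4 m)"
    by (rule finite_subset[of _ "{..m} \<times> {..m} \<times> {..m} \<times> {..m}"]) (auto simp: idx4_def)
  show "finite (idx5 m)"
    by (rule finite_subset[of _ "{..m} \<times> {..m} \<times> {..m} \<times> {..m} \<times> {..m}"]) (auto simp: idx5_def)
qed

text \<open>Only the tuple with first entry \<open>m\<close> and zeros elsewhere survives. Read from
  right to left, this completes a single term of the differential to a full convolution sum.\<close>

lemma sum_idx_top:
  "(\<And>i j. i < m \<Longrightarrow> T2 i j = 0) \<Longrightarrow> (\<Sum>(i, j)\<in>idx2 m. T2 i j) = T2 m 0"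
  "(\<And>i j k. i < m \<Longrightarrow> T3 i j k = 0) \<Longrightarrow> (\<Sum>(i, j, k)\<in>idx3 m. T3 i j k) = T3 m 0 0"
  "(\<And>i j k l. i < m \<Longrightarrow> T4 i j k l = 0) \<Longrightarrow> (\<Sum>(i, j, k, l)\<in>idx4 m. T4 i j k l) = T4 m 0 0 0"
proof -
  assume *: "\<And>i j. i < m \<Longrightarrow> T2 i j = 0"
  have "(\<Sum>(i, j)\<in>idx2 m. T2 i j) = (\<Sum>(i, j)\<in>{(m, 0)}. T2 i j)"
    by (rule sum.mono_neutral_right) (auto simp: finite_idx, auto simp: idx2_def intro!: *)
  then show "(\<Sum>(i, j)\<in>idx2 m. T2 i j) = T2 m 0" by simp
next
  assume *: "\<And>i j k. i < m \<Longrightarrow> T3 i j k = 0"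
  have "(\<Sum>(i, j, k)\<in>idx3 m. T3 i j k) = (\<Sum>(i, j, k)\<in>{(m, 0, 0)}. T3 i j k)"
    by (rule sum.mono_neutral_right) (auto simp: finite_idx, auto simp: idx3_def intro!: *)
  then show "(\<Sum>(i, j, k)\<in>idx3 m. T3 i j k) = T3 m 0 0" by simp
next
  assume *: "\<And>i j k l. i < m \<Longrightarrow> T4 i j k l = 0"
  have "(\<Sum>(i, j, k, l)\<in>idx4 m. T4 i j k l) = (\<Sum>(i, j, k, l)\<in>{(m, 0, 0, 0)}. T4 i j k l)"
    by (rule sum.mono_neutral_right) (auto simp: finite_idx, auto simp: idx4_def intro!: *)
  then show "(\<Sum>(i, j, k, l)\<in>idx4 m. T4 i j k l) = T4 m 0 0 0" by simp
qed

lemma sum_subtractf_split: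
  fixes g2 h2 :: "'a \<Rightarrow> 'b \<Rightarrow> 'v::ab_group_add"
    and g3 h3 :: "'a \<Rightarrow> 'b \<Rightarrow> 'c \<Rightarrow> 'v" and g4 h4 :: "'a \<Rightarrow> 'b \<Rightarrow> 'c \<Rightarrow> 'd \<Rightarrow> 'v"
  shows "(\<Sum>(i, j)\<in>S2. g2 i j - h2 i j) = (\<Sum>(i, j)\<in>S2. g2 i j) - (\<Sum>(i, j)\<in>S2. h2 i j)"
    and "(\<Sum>(i, j, k)\<in>S3. g3 i j k - h3 i j k)
      = (\<Sum>(i, j, k)\<in>S3. g3 i j k) - (\<Sum>(i, j, k)\<in>S3. h3 i j k)"
    and "(\<Sum>(i, j, k, l)\<in>S4. g4 i j k l - h4 i j k l)
      = (\<Sum>(i, j, k, l)\<in>S4. g4 i j k l) - (\<Sum>(i, j, k, l)\<in>S4. h4 i j k l)"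
  unfolding split_beta by (rule sum_subtractf)+

text \<open>The nested sum runs over \<open>Sigma I J\<close>; \<open>e\<close> flattens its index
  pairs into \<open>K\<close> and \<open>d\<close> is the inverse.\<close>

lemma sum_nested_reindex:
  assumes "finite I" "\<And>x. x \<in> I \<Longrightarrow> finite (J x)"
    and "\<And>x y. x \<in> I \<Longrightarrow> y \<in> J x \<Longrightarrow> e (x, y) \<in> K \<and> d (e (x, y)) = (x, y) \<and> T (e (x, y)) = g x y"
    and "\<And>z. z \<in> K \<Longrightarrow> d z \<in> Sigma I J \<and> e (d z) = z"
  shows "(\<Sum>x\<in>I. \<Sum>y\<in>J x. g x y) = sum T K"
proof -
  have "(\<Sum>x\<in>I. \<Sum>y\<in>J x. g x y) = (\<Sum>(x, y)\<in>Sigma I J. g x y)"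
    using assms(1,2) by (simp add: sum.Sigma)
  also have "\<dots> = sum T K"
    using assms(3,4) by (intro sum.reindex_bij_witness[of _ d e]) auto
  finally show ?thesis .
qed

text \<open>The inner pair splits \<open>i\<close>, so the three indices \<open>a\<close>,
  \<open>b\<close>, \<open>j\<close> sum to \<open>m\<close>. The variants differ in the place where
  the outer index \<open>j\<close> enters the summand.\<close>

lemma sum_idx22:
  fixes T :: "nat \<Rightarrow> nat \<Rightarrow> nat \<Rightarrow> 'v::comm_monoid_add"
  shows "(\<Sum>(i, j)\<in>idx2 m. \<Sum>(a, b)\<in>idx2 i. T a b j) = (\<Sum>(a, b, c)\<in>idx3 m. T a b c)"
    and "(\<Sum>(i, j)\<in>idx2 m. \<Sum>(a, b)\<in>idx2 i. T j a b) = (\<Sum>(a, b, c)\<in>idx3 m. T a b c)"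
    and "(\<Sum>(i, j)\<in>idx2 m. \<Sum>(a, b)\<in>idx2 i. T a j b) = (\<Sum>(a, b, c)\<in>idx3 m. T a b c)"
proof -
  show "(\<Sum>(i, j)\<in>idx2 m. \<Sum>(a, b)\<in>idx2 i. T a b j) = (\<Sum>(a, b, c)\<in>idx3 m. T a b c)"
    unfolding split_beta
    by (rule sum_nested_reindex[where e = "\<lambda>((i, j), (a, b)). (a, b, j)"
          and d = "\<lambda>(a, b, j). ((a + b, j), (a, b))"])
      (auto simp: finite_idx, auto simp: idx2_def idx3_def)
  show "(\<Sum>(i, j)\<in>idx2 m. \<Sum>(a, b)\<in>idx2 i. T j a b) = (\<Sum>(a, b, c)\<in>idx3 m. T a b c)"
    unfolding split_beta
    by (rule sum_nested_reindex[where e = "\<lambda>((i, j), (a, b)). (j, a, b)"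
          and d = "\<lambda>(j, a, b). ((a + b, j), (a, b))"])
      (auto simp: finite_idx, auto simp: idx2_def idx3_def)
  show "(\<Sum>(i, j)\<in>idx2 m. \<Sum>(a, b)\<in>idx2 i. T a j b) = (\<Sum>(a, b, c)\<in>idx3 m. T a b c)"
    unfolding split_beta
    by (rule sum_nested_reindex[where e = "\<lambda>((i, j), (a, b)). (a, j, b)"
          and d = "\<lambda>(a, j, b). ((a + b, j), (a, b))"])
      (auto simp: finite_idx, auto simp: idx2_def idx3_def)
qed

text \<open>The argument orders here and below follow the composites they serve: first the index of
  the comultiplication that acts first, then that of the factor next to the inner composite, then
  the indices of the inner composite.\<close>

lemma sum_idx32:
  fixes T :: "nat \<Rightarrow> nat \<Rightarrow> nat \<Rightarrow> nat \<Rightarrow> 'v::comm_monoid_add"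
  shows "(\<Sum>(i, j, k)\<in>idx3 m. \<Sum>(a, b)\<in>idx2 i. T k j a b) = (\<Sum>(a, b, c, d)\<in>idx4 m. T a b c d)"
  unfolding split_beta
  by (rule sum_nested_reindex[where e = "\<lambda>((i, j, k), (a, b)). (k, j, a, b)"
        and d = "\<lambda>(k, j, a, b). ((a + b, j, k), (a, b))"])
    (auto simp: finite_idx, auto simp: idx2_def idx3_def idx4_def)

lemma sum_idx23:
  fixes T :: "nat \<Rightarrow> nat \<Rightarrow> nat \<Rightarrow> nat \<Rightarrow> 'v::comm_monoid_add"
  shows "(\<Sum>(i, j)\<in>idx2 m. \<Sum>(a, b, c)\<in>idx3 i. T a c j b) = (\<Sum>(a, b, c, d)\<in>idx4 m. T a b c d)"
    and "(\<Sum>(i, j)\<in>idx2 m. \<Sum>(a, b, c)\<in>idx3 i. T a b j c) = (\<Sum>(a, b, c, d)\<in>idx4 m. T a b c d)"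
proof -
  show "(\<Sum>(i, j)\<in>idx2 m. \<Sum>(a, b, c)\<in>idx3 i. T a c j b) = (\<Sum>(a, b, c, d)\<in>idx4 m. T a b c d)"
    unfolding split_beta
    by (rule sum_nested_reindex[where e = "\<lambda>((i, j), (a, b, c)). (a, c, j, b)"
          and d = "\<lambda>(a, c, j, b). ((a + b + c, j), (a, b, c))"])
      (auto simp: finite_idx, auto simp: idx2_def idx3_def idx4_def)
  show "(\<Sum>(i, j)\<in>idx2 m. \<Sum>(a, b, c)\<in>idx3 i. T a b j c) = (\<Sum>(a, b, c, d)\<in>idx4 m. T a b c d)"
    unfolding split_beta
    by (rule sum_nested_reindex[where e = "\<lambda>((i, j), (a, b, c)). (a, b, j, c)"
          and d = "\<lambda>(a, b, j, c). ((a + b + c, j), (a, b, c))"])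
      (auto simp: finite_idx, auto simp: idx2_def idx3_def idx4_def)
qed

lemma sum_idx33:
  fixes T :: "nat \<Rightarrow> nat \<Rightarrow> nat \<Rightarrow> nat \<Rightarrow> nat \<Rightarrow> 'v::comm_monoid_add"
  shows "(\<Sum>(i, j, k)\<in>idx3 m. \<Sum>(a, b, c)\<in>idx3 i. T k j a b c) = (\<Sum>(a, b, c, d, e)\<in>idx5 m. T a b c d e)"
  unfolding split_beta
  by (rule sum_nested_reindex[where e = "\<lambda>((i, j, k), (a, b, c)). (k, j, a, b, c)"
        and d = "\<lambda>(k, j, a, b, c). ((a + b + c, j, k), (a, b, c))"])
    (auto simp: finite_idx, auto simp: idx3_def idx5_def)

lemma sum_idx42:
  fixes T :: "nat \<Rightarrow> nat \<Rightarrow> nat \<Rightarrow> nat \<Rightarrow> nat \<Rightarrow> 'v::comm_monoid_add"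
  shows "(\<Sum>(i, j, k, l)\<in>idx4 m. \<Sum>(a, b)\<in>idx2 i. T b j a k l) = (\<Sum>(a, b, c, d, e)\<in>idx5 m. T a b c d e)"
    and "(\<Sum>(i, j, k, l)\<in>idx4 m. \<Sum>(a, b)\<in>idx2 i. T b l a j k) = (\<Sum>(a, b, c, d, e)\<in>idx5 m. T a b c d e)"
proof -
  show "(\<Sum>(i, j, k, l)\<in>idx4 m. \<Sum>(a, b)\<in>idx2 i. T b j a k l) = (\<Sum>(a, b, c, d, e)\<in>idx5 m. T a b c d e)"
    unfolding split_beta
    by (rule sum_nested_reindex[where e = "\<lambda>((i, j, k, l), (a, b)). (b, j, a, k, l)"
          and d = "\<lambda>(b, j, a, k, l). ((a + b, j, k, l), (a, b))"])
      (auto simp: finite_idx, auto simp: idx2_def idx4_def idx5_def)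
  show "(\<Sum>(i, j, k, l)\<in>idx4 m. \<Sum>(a, b)\<in>idx2 i. T b l a j k) = (\<Sum>(a, b, c, d, e)\<in>idx5 m. T a b c d e)"
    unfolding split_beta
    by (rule sum_nested_reindex[where e = "\<lambda>((i, j, k, l), (a, b)). (b, l, a, j, k)"
          and d = "\<lambda>(b, l, a, j, k). ((a + b, j, k, l), (a, b))"])
      (auto simp: finite_idx, auto simp: idx2_def idx4_def idx5_def)
qed

section \<open>The defect of coassociativity\<close>

text \<open>The coefficient of t^m in the defect of coassociativity of the family;
  \<open>D j\<close> acts first and \<open>D i\<close> second.\<close>

definition assoc_defect ::
  "('k::field \<Rightarrow> 'a::ab_group_add \<Rightarrow> 'a) \<Rightarrow> (nat \<Rightarrow> 'a \<Rightarrow> ('a list, 'k) tensor) \<Rightarrow> nat \<Rightarrow>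
   'a \<Rightarrow> ('a list, 'k) tensor" where
  "assoc_defect sA D m =
     (\<Sum>(i, j)\<in>idx2 m. conv sA (D j) (D i) (idt sA) - conv sA (D j) (idt sA) (D i))"

lemma tensor_map_assoc_defect:
  assumes D: "\<And>n. tensor_map sA sA 2 (D n)"
  shows "tensor_map sA sA 3 (assoc_defect sA D m)"
proof -
  note A = tensor_mapD(1)[OF D]
  have "tensor_map sA sA 3 (conv sA (D j) (D i) (idt sA) - conv sA (D j) (idt sA) (D i))" for i j
    using tensor_map_conv[OF D D tensor_map_idt[OF A]] tensor_map_conv[OF D tensor_map_idt[OF A] D]
    by (intro tensor_map_diff) (simp_all add: numeral_3_eq_3 numeral_2_eq_2)
  then show ?thesis
    unfolding assoc_defect_def by (intro tensor_map_sum A) auto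
qed

text \<open>With the sums \<open>X\<close>, \<open>Y\<close>, \<open>Z\<close>, \<open>V\<close>,
  \<open>U\<close> defined below, the differential becomes (X - Y) - (Z - U) + (V - X) - (U - Y) +
  (Z - V) = 0.\<close>

lemma diff_self_assoc_defect:
  fixes sA :: "'k::field \<Rightarrow> 'a::ab_group_add \<Rightarrow> 'a"
  assumes D: "\<And>n. tensor_map sA sA 2 (D n)" and zero: "\<And>i. i < m \<Longrightarrow> assoc_defect sA D i = 0"
  shows "diff_self sA (D 0) 3 (assoc_defect sA D m) = 0"
proof -
  let ?I = "idt sA" and ?O = "assoc_defect sA D"
  note A = tensor_mapD(1)[OF D]
  note I = tensor_map_idt[OF A]
  note O = tensor_map_assoc_defect[of sA D, OF D]
  \<comment> \<open>These are the five ways to comultiply three times into four factors, one for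
    each bracketing. \<open>D c\<close> always acts first; only in \<open>U\<close> do the other two
    maps act on different factors.\<close>
  define X where "X a b c = conv sA (D c) ?I (conv sA (D b) (D a) ?I)" for a b c
  define Y where "Y a b c = conv sA (D c) ?I (conv sA (D b) ?I (D a))" for a b c
  define Z where "Z a b c = conv sA (D c) (conv sA (D b) (D a) ?I) ?I" for a b c
  define V where "V a b c = conv sA (D c) (conv sA (D b) ?I (D a)) ?I" for a b c
  define U where "U a b c = conv sA (D c) (D a) (D b)" for a b c
  let ?S = "\<lambda>T. \<Sum>(a, b, c)\<in>idx3 m. T a b c :: 'a \<Rightarrow> ('a list, 'k) tensor"
  note cI = tensor_map_conv[OF D D I] tensor_map_conv[OF D I D]
  have c3: "tensor_map sA sA (2 + 1) (conv sA (D b) (D a) ?I)" "tensor_map sA sA (2 + 1) (conv sA (D b) ?I (D a))" for a b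
    using cI by (simp_all add: add.commute)
  note pull = sum_subtractf tmap_comp_sum tmap_comp_diff
  have T1: "conv sA (D 0) ?I (?O m) = ?S X - ?S Y"
  proof -
    \<comment> \<open>The added summands contain \<open>?O i\<close> with \<open>i < m\<close> and
      are zero. The other four terms are completed in the same way.\<close>
    have "conv sA (D 0) ?I (?O m) = (\<Sum>(i, j)\<in>idx2 m. conv sA (D j) ?I (?O i))"
      by (rule sum_idx_top(1)[symmetric]) (simp only: zero conv_zero_right[OF D I])
    also have "\<dots> = (\<Sum>(i, j)\<in>idx2 m. (\<Sum>(a, b)\<in>idx2 i. X a b j) - (\<Sum>(a, b)\<in>idx2 i. Y a b j))"
      unfolding assoc_defect_def split_beta
      unfolding conv_sum_right[OF D I tensor_map_diff[OF c3]] conv_diff_right[OF D I c3]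
      by (simp only: sum_subtractf X_def Y_def)
    finally show ?thesis
      by (simp only: sum_subtractf_split sum_idx22(1))
  qed
  have T5: "conv sA (D 0) (?O m) ?I = ?S Z - ?S V"
  proof -
    have "conv sA (D 0) (?O m) ?I = (\<Sum>(i, j)\<in>idx2 m. conv sA (D j) (?O i) ?I)"
      by (rule sum_idx_top(1)[symmetric]) (simp only: zero conv_zero_left[OF D I])
    also have "\<dots> = (\<Sum>(i, j)\<in>idx2 m. (\<Sum>(a, b)\<in>idx2 i. Z a b j) - (\<Sum>(a, b)\<in>idx2 i. V a b j))"
      unfolding assoc_defect_def split_beta
      unfolding conv_sum_left[OF D I tensor_map_diff[OF c3]] conv_diff_left[OF D c3 I]
      by (simp only: sum_subtractf Z_def V_def)
    finally show ?thesis
      by (simp only: sum_subtractf_split sum_idx22(1))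
  qed
  have T2: "tmap sA [D 0, ?I, ?I] \<circ> ?O m = ?S Z - ?S U"
  proof -
    have "tmap sA [D 0, ?I, ?I] \<circ> ?O m = (\<Sum>(i, j)\<in>idx2 m. tmap sA [D j, ?I, ?I] \<circ> ?O i)"
      by (rule sum_idx_top(1)[symmetric]) (simp only: zero tmap_comp_zero)
    also have "\<dots> = (\<Sum>(i, j)\<in>idx2 m. (\<Sum>(a, b)\<in>idx2 i. Z j a b) - (\<Sum>(a, b)\<in>idx2 i. U j a b))"
      unfolding assoc_defect_def split_beta
      \<comment> \<open>\<open>D j\<close> acts on one factor and \<open>D a\<close> on the other,
        so \<open>conv_idt_idt\<close> reduces the mixed composite to the balanced one.\<close>
      by (simp only: pull tmap3_conv_idt_left[OF D D D I I] tmap3_conv_idt_right[OF D D D I I]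
        conv_idt_idt[OF D] Z_def U_def)
    finally show ?thesis
      by (simp only: sum_subtractf_split sum_idx22(2))
  qed
  have T3: "tmap sA [?I, D 0, ?I] \<circ> ?O m = ?S V - ?S X"
  proof -
    have "tmap sA [?I, D 0, ?I] \<circ> ?O m = (\<Sum>(i, j)\<in>idx2 m. tmap sA [?I, D j, ?I] \<circ> ?O i)"
      by (rule sum_idx_top(1)[symmetric]) (simp only: zero tmap_comp_zero)
    also have "\<dots> = (\<Sum>(i, j)\<in>idx2 m. (\<Sum>(a, b)\<in>idx2 i. V j a b) - (\<Sum>(a, b)\<in>idx2 i. X j a b))"
      unfolding assoc_defect_def split_beta
      by (simp only: pull tmap3_conv_idt_left[OF D D I D I] tmap3_conv_idt_right[OF D D I D I]
        V_def X_def)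
    finally show ?thesis
      by (simp only: sum_subtractf_split sum_idx22(2))
  qed
  have T4: "tmap sA [?I, ?I, D 0] \<circ> ?O m = ?S U - ?S Y"
  proof -
    have "tmap sA [?I, ?I, D 0] \<circ> ?O m = (\<Sum>(i, j)\<in>idx2 m. tmap sA [?I, ?I, D j] \<circ> ?O i)"
      by (rule sum_idx_top(1)[symmetric]) (simp only: zero tmap_comp_zero)
    \<comment> \<open>The balanced composite appears again, now with \<open>D j\<close> on the
      right. Hence \<open>j\<close> is the middle argument of \<open>U\<close>, and the third
      reindexing applies.\<close>
    also have "\<dots> = (\<Sum>(i, j)\<in>idx2 m. (\<Sum>(a, b)\<in>idx2 i. U a j b) - (\<Sum>(a, b)\<in>idx2 i. Y j a b))"
      unfolding assoc_defect_def split_beta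
      by (simp only: pull tmap3_conv_idt_left[OF D D I I D] tmap3_conv_idt_right[OF D D I I D]
        conv_idt_idt[OF D] U_def Y_def)
    finally show ?thesis
      by (simp only: sum_subtractf_split sum_idx22(3)[where T = U] sum_idx22(2)[where T = Y])
  qed
  show ?thesis
    unfolding diff_self_3[OF D O] T1 T2 T3 T4 T5 by simp
qed

section \<open>The defect of being a morphism\<close>

definition mor_defect ::
  "('k::field \<Rightarrow> 'b::ab_group_add \<Rightarrow> 'b) \<Rightarrow> (nat \<Rightarrow> 'a \<Rightarrow> ('a list, 'k) tensor) \<Rightarrow>
   (nat \<Rightarrow> 'b \<Rightarrow> ('b list, 'k) tensor) \<Rightarrow> (nat \<Rightarrow> 'a \<Rightarrow> 'b) \<Rightarrow> nat \<Rightarrow>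
   'a \<Rightarrow> ('b list, 'k) tensor" where
  "mor_defect sB DA DB F m =
     (\<Sum>(i, j, k)\<in>idx3 m. conv sB (DA i) (idt sB \<circ> F j) (idt sB \<circ> F k))
     - (\<Sum>(i, j)\<in>idx2 m. DB i \<circ> F j)"

text \<open>The differential expands to (R - M1) - (M2 - G2) + (M1 - G1) - (L - M2). The mixed sums
  cancel and leave (G2 - G1) - (L - R), which is the expansion of the right-hand side.\<close>

lemma diff_mor_mor_defect:
  fixes sA :: "'k::field \<Rightarrow> 'a::ab_group_add \<Rightarrow> 'a" and sB :: "'k \<Rightarrow> 'b::ab_group_add \<Rightarrow> 'b"
  assumes DA: "\<And>n. tensor_map sA sA 2 (DA n)" and DB: "\<And>n. tensor_map sB sB 2 (DB n)"
    and F: "\<And>n. Vector_Spaces.linear sA sB (F n)"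
    and zeroA: "\<And>i. i < m \<Longrightarrow> assoc_defect sA DA i = 0"
    and zeroB: "\<And>i. i < m \<Longrightarrow> assoc_defect sB DB i = 0"
    and zero: "\<And>i. i < m \<Longrightarrow> mor_defect sB DA DB F i = 0"
  shows "diff_mor sA (DA 0) sB (DB 0) (F 0) 2 (mor_defect sB DA DB F m)
    = (assoc_defect sB DB m \<circ> F 0)
      - (tmap sB [idt sB \<circ> F 0, idt sB \<circ> F 0, idt sB \<circ> F 0] \<circ> assoc_defect sA DA m)"
proof -
  define f where "f n = idt sB \<circ> F n" for n
  let ?I = "idt sB" and ?O = "mor_defect sB DA DB F"
  note A = tensor_mapD(1)[OF DA] and B = tensor_mapD(1)[OF DB]
  note I = tensor_map_idt[OF B]
  have f: "tensor_map sA sB 1 (f n)" for n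
    unfolding f_def by (rule tensor_map_comp[OF I F])
  have P: "tensor_map sA sB 2 (conv sB (DA i) (f j) (f k))" for i j k
    using tensor_map_conv[OF DA f f] by (simp add: numeral_2_eq_2)
  have H: "tensor_map sA sB 2 (DB i \<circ> F j)" for i j
    by (rule tensor_map_comp[OF DB F])
  have SP: "tensor_map sA sB 2 (\<Sum>x\<in>S. case x of (i, j, k) \<Rightarrow> conv sB (DA i) (f j) (f k))" for S
    by (rule tensor_map_sum[OF A B]) (auto intro: P)
  have SH: "tensor_map sA sB 2 (\<Sum>x\<in>S. case x of (i, j) \<Rightarrow> DB i \<circ> F j)" for S
    by (rule tensor_map_sum[OF A B]) (auto intro: H)
  have O_eq: "?O i = (\<Sum>(i, j, k)\<in>idx3 i. conv sB (DA i) (f j) (f k)) - (\<Sum>(i, j)\<in>idx2 i. DB i \<circ> F j)" for i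
    unfolding mor_defect_def f_def ..
  have O: "tensor_map sA sB 2 (?O i)" for i
    unfolding O_eq by (rule tensor_map_diff[OF SP SH])
  \<comment> \<open>\<open>R\<close> and \<open>L\<close> comultiply twice in the source before
    applying the maps \<open>F\<close>; \<open>G1\<close> and \<open>G2\<close> apply one
    \<open>F\<close> and then comultiply twice in the target; \<open>M1\<close> and
    \<open>M2\<close> comultiply once on each side.\<close>
  define R where "R a b c d e = conv sB (DA a) (f b) (conv sB (DA c) (f d) (f e))" for a b c d e
  define L where "L a b c d e = conv sB (DA a) (conv sB (DA c) (f d) (f e)) (f b)" for a b c d e
  define M1 where "M1 a b c d = conv sB (DA a) (f b) (DB c \<circ> F d)" for a b c d
  define M2 where "M2 a b c d = conv sB (DA a) (DB c \<circ> F d) (f b)" for a b c d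
  define G1 where "G1 a b c = conv sB (DB b) ?I (DB a) \<circ> F c" for a b c
  define G2 where "G2 a b c = conv sB (DB b) (DB a) ?I \<circ> F c" for a b c
  let ?S3 = "\<lambda>T. \<Sum>(a, b, c)\<in>idx3 m. T a b c :: 'a \<Rightarrow> ('b list, 'k) tensor"
  let ?S4 = "\<lambda>T. \<Sum>(a, b, c, d)\<in>idx4 m. T a b c d :: 'a \<Rightarrow> ('b list, 'k) tensor"
  let ?S5 = "\<lambda>T. \<Sum>(a, b, c, d, e)\<in>idx5 m. T a b c d e :: 'a \<Rightarrow> ('b list, 'k) tensor"
  have T1: "conv sB (DA 0) (f 0) (?O m) = ?S5 R - ?S4 M1"
  proof -
    \<comment> \<open>Both the comultiplication and the neighbouring \<open>f\<close> carry an
      index, so the completed sum runs over triples.\<close>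
    have "conv sB (DA 0) (f 0) (?O m) = (\<Sum>(i, j, k)\<in>idx3 m. conv sB (DA k) (f j) (?O i))"
      by (rule sum_idx_top(2)[symmetric]) (simp only: zero conv_zero_right[OF DA f])
    also have "\<dots> = (\<Sum>(i, j, k)\<in>idx3 m.
        (\<Sum>(a, b, c)\<in>idx3 i. R k j a b c) - (\<Sum>(a, b)\<in>idx2 i. M1 k j a b))"
      unfolding O_eq conv_diff_right[OF DA f SP SH] split_beta
      by (simp only: conv_sum_right[OF DA f P] conv_sum_right[OF DA f H] R_def M1_def)
    finally show ?thesis
      by (simp only: sum_subtractf_split sum_idx33 sum_idx32)
  qed
  have T2: "conv sB (DA 0) (?O m) (f 0) = ?S5 L - ?S4 M2"
  proof -
    have "conv sB (DA 0) (?O m) (f 0) = (\<Sum>(i, j, k)\<in>idx3 m. conv sB (DA k) (?O i) (f j))"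
      by (rule sum_idx_top(2)[symmetric]) (simp only: zero conv_zero_left[OF DA f])
    also have "\<dots> = (\<Sum>(i, j, k)\<in>idx3 m.
        (\<Sum>(a, b, c)\<in>idx3 i. L k j a b c) - (\<Sum>(a, b)\<in>idx2 i. M2 k j a b))"
      unfolding O_eq conv_diff_left[OF DA SP SH f] split_beta
      by (simp only: conv_sum_left[OF DA f P] conv_sum_left[OF DA f H] L_def M2_def)
    finally show ?thesis
      by (simp only: sum_subtractf_split sum_idx33 sum_idx32)
  qed
  have T3: "tmap sB [DB 0, ?I] \<circ> ?O m = ?S4 M2 - ?S3 G2"
  proof -
    have "tmap sB [DB 0, ?I] \<circ> ?O m = (\<Sum>(i, j)\<in>idx2 m. tmap sB [DB j, ?I] \<circ> ?O i)"
      by (rule sum_idx_top(1)[symmetric]) (simp only: zero tmap_comp_zero)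
    \<comment> \<open>\<open>DB j\<close> is composed with the left factor \<open>F b\<close>, while
      \<open>F c\<close> remains alone on the right; this gives the argument order of
      \<open>M2\<close>.\<close>
    also have "\<dots> = (\<Sum>(i, j)\<in>idx2 m.
        (\<Sum>(a, b, c)\<in>idx3 i. M2 a c j b) - (\<Sum>(a, b)\<in>idx2 i. G2 j a b))"
      unfolding mor_defect_def split_beta
      unfolding tmap_comp_diff tmap_comp_sum tmap2_conv_linear[OF DA F F DB I]
      by (simp only: M2_def G2_def f_def conv_def comp_assoc)
    finally show ?thesis
      by (simp only: sum_subtractf_split sum_idx23(1) sum_idx22(2))
  qed
  have T4: "tmap sB [?I, DB 0] \<circ> ?O m = ?S4 M1 - ?S3 G1"
  proof -
    have "tmap sB [?I, DB 0] \<circ> ?O m = (\<Sum>(i, j)\<in>idx2 m. tmap sB [?I, DB j] \<circ> ?O i)"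
      by (rule sum_idx_top(1)[symmetric]) (simp only: zero tmap_comp_zero)
    also have "\<dots> = (\<Sum>(i, j)\<in>idx2 m.
        (\<Sum>(a, b, c)\<in>idx3 i. M1 a b j c) - (\<Sum>(a, b)\<in>idx2 i. G1 j a b))"
      unfolding mor_defect_def split_beta
      unfolding tmap_comp_diff tmap_comp_sum tmap2_conv_linear[OF DA F F I DB]
      by (simp only: M1_def G1_def f_def conv_def comp_assoc)
    finally show ?thesis
      by (simp only: sum_subtractf_split sum_idx23(2) sum_idx22(2))
  qed
  have T5: "assoc_defect sB DB m \<circ> F 0 = ?S3 G2 - ?S3 G1"
  proof -
    have "assoc_defect sB DB m \<circ> F 0 = (\<Sum>(i, j)\<in>idx2 m. assoc_defect sB DB i \<circ> F j)"
      by (rule sum_idx_top(1)[symmetric]) (simp only: zeroB comp_zero_left)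
    also have "\<dots> = (\<Sum>(i, j)\<in>idx2 m. (\<Sum>(a, b)\<in>idx2 i. G2 a b j) - (\<Sum>(a, b)\<in>idx2 i. G1 a b j))"
      unfolding assoc_defect_def split_beta
      by (simp only: comp_sum_left comp_diff_left sum_subtractf G1_def G2_def)
    finally show ?thesis
      by (simp only: sum_subtractf_split sum_idx22(1))
  qed
  have T6: "tmap sB [f 0, f 0, f 0] \<circ> assoc_defect sA DA m = ?S5 L - ?S5 R"
  proof -
    \<comment> \<open>Three copies of \<open>f\<close> and the defect each carry an index, hence
      sums over quadruples; the added terms vanish by \<open>zeroA\<close>.\<close>
    have "tmap sB [f 0, f 0, f 0] \<circ> assoc_defect sA DA m
        = (\<Sum>(i, j, k, l)\<in>idx4 m. tmap sB [f j, f k, f l] \<circ> assoc_defect sA DA i)"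
      by (rule sum_idx_top(3)[symmetric]) (simp only: zeroA tmap_comp_zero)
    also have "\<dots> = (\<Sum>(i, j, k, l)\<in>idx4 m.
        (\<Sum>(a, b)\<in>idx2 i. L b l a j k) - (\<Sum>(a, b)\<in>idx2 i. R b j a k l))"
      unfolding assoc_defect_def split_beta
      by (simp only: tmap_comp_diff tmap_comp_sum sum_subtractf L_def R_def
        tmap3_conv_idt_left[OF DA DA f f f] tmap3_conv_idt_right[OF DA DA f f f])
    finally show ?thesis
      by (simp only: sum_subtractf_split sum_idx42(1)[where T = R] sum_idx42(2)[where T = L])
  qed
  show ?thesis
    unfolding diff_mor_2[OF DA F O] f_def[symmetric] T1 T2 T3 T4 T5 T6 by simp
qed

lemma tensor_map_mor_defect:
  assumes DA: "\<And>n. tensor_map sA sA 2 (DA n)" and DB: "\<And>n. tensor_map sB sB 2 (DB n)"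
    and F: "\<And>n. Vector_Spaces.linear sA sB (F n)"
  shows "tensor_map sA sB 2 (mor_defect sB DA DB F m)"
proof -
  note A = tensor_mapD(1)[OF DA] and B = tensor_mapD(1)[OF DB]
  note f = tensor_map_comp[OF tensor_map_idt[OF B] F]
  have "tensor_map sA sB 2 (conv sB (DA i) (idt sB \<circ> F j) (idt sB \<circ> F k))" for i j k
    using tensor_map_conv[OF DA f f] by (simp add: numeral_2_eq_2)
  then show ?thesis
    unfolding mor_defect_def using tensor_map_comp[OF DB F]
    by (intro tensor_map_diff tensor_map_sum A B) auto
qed

section \<open>From 1-cochains to linear maps between the underlying spaces\<close>

text \<open>The universal property applied to \<open>hd\<close>, which is linear on words of length
  one, yields a left inverse of \<open>idt sA\<close>.\<close>

lemma idt_inj: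
  assumes A: "vector_space sA" and eq: "idt sA x = idt sA y"
  shows "x = y"
proof -
  interpret A: vector_space sA by (rule A)
  have "\<And>xs ys. length xs + length ys + 1 = 1 \<Longrightarrow> Vector_Spaces.linear sA sA (\<lambda>a. hd (xs @ a # ys))"
    using A.linear_ident by simp
  then have "\<exists>L. Vector_Spaces.linear fscale sA L \<and>
      (\<forall>xs. length xs = 1 \<longrightarrow> L (tpure sA xs) = hd xs)"
    using tpow_universal[OF A A, of 1 hd] by (simp only:)
  then obtain L where L: "\<forall>xs. length xs = 1 \<longrightarrow> L (tpure sA xs) = hd xs"
    by (elim exE conjE)
  then have "L (idt sA z) = z" for z
    by (simp add: idt_def)
  then show ?thesis
    using eq by metis
qed

text \<open>A deformation gives linearity of \<open>F n\<close> only through its cochain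
  \<open>idt sB \<circ> F n\<close>; injectivity of \<open>idt sB\<close> transfers it to
  \<open>F n\<close>.\<close>

lemma linear_of_idt_comp:
  assumes B: "vector_space sB" and lin: "Vector_Spaces.linear sA fscale (idt sB \<circ> g)"
  shows "Vector_Spaces.linear sA sB g"
proof -
  have I: "idt sB (u + v) = idt sB u + idt sB v" "idt sB (sB c u) = fscale c (idt sB u)" for u v c
    using tensor_mapD(3)[OF tensor_map_idt[OF B]] by (simp_all add: Vector_Spaces.linear_iff)
  have g: "vector_space sA" "idt sB (g (x + y)) = idt sB (g x) + idt sB (g y)"
    "idt sB (g (sA c x)) = fscale c (idt sB (g x))" for x y c
    using lin unfolding Vector_Spaces.linear_iff comp_def by blast+
  have "g (x + y) = g x + g y" for x y
    by (rule idt_inj[OF B]) (simp only: g I)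
  moreover have "g (sA c x) = sB c (g x)" for c x
    by (rule idt_inj[OF B]) (simp only: g I)
  ultimately show ?thesis
    using B g(1) by (simp add: Vector_Spaces.linear_iff)
qed

section \<open>Obstructions as defects of the truncated families\<close>

text \<open>The values of a deformation beyond index \<open>N\<close> are unspecified. Setting them
  to zero makes unrestricted sums over \<open>idx2\<close> and \<open>idx3\<close> agree with the
  bounded ones.\<close>

definition truncate :: "nat \<Rightarrow> (nat \<Rightarrow> 'x \<Rightarrow> 'y::zero) \<Rightarrow> nat \<Rightarrow> 'x \<Rightarrow> 'y" where
  "truncate N D n = (if n \<le> N then D n else 0)"

text \<open>In degree \<open>N + 1\<close> only the pairs (0, N + 1) and (N + 1, 0) use an index
  beyond \<open>N\<close>, and the truncated family vanishes there. The remaining pairs are indexed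
  by \<open>i\<close> from 1 to \<open>N\<close>.\<close>

lemma ob_coalg_eq_assoc_defect:
  assumes D: "\<And>n. n \<le> N \<Longrightarrow> tensor_map sA sA 2 (D n)" and A: "vector_space sA"
  shows "ob_coalg sA N D = assoc_defect sA (truncate N D) (N + 1)"
proof -
  let ?E = "truncate N D"
  have E: "tensor_map sA sA 2 (?E n)" for n
    using D tensor_map_zero[OF A A] by (simp add: truncate_def)
  let ?g = "\<lambda>(i, j). conv sA (?E j) (?E i) (idt sA) - conv sA (?E j) (idt sA) (?E i)"
  have z: "?E (Suc N) = 0" by (simp add: truncate_def)
  have c0: "conv sA 0 g h = 0" for g h
    unfolding conv_def by (rule tmap_comp_zero)
  have "assoc_defect sA ?E (N + 1) = sum ?g ((\<lambda>i. (i, N + 1 - i)) ` {1..N})"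
    unfolding assoc_defect_def
  proof (rule sum.mono_neutral_right[OF finite_idx(1)])
    show "\<forall>x\<in>idx2 (N + 1) - (\<lambda>i. (i, N + 1 - i)) ` {1..N}. ?g x = 0"
    proof
      fix x assume "x \<in> idx2 (N + 1) - (\<lambda>i. (i, N + 1 - i)) ` {1..N}"
      then have "x = (0, Suc N) \<or> x = (Suc N, 0)"
        by (cases x) (auto simp: idx2_def image_iff)
      then show "?g x = 0"
        by (elim disjE) (simp_all only: split z c0 conv_zero_left[OF E tensor_map_idt[OF A]]
            conv_zero_right[OF E tensor_map_idt[OF A]] diff_self)
    qed
  qed (auto simp: idx2_def)
  also have "\<dots> = (\<Sum>i = 1..N. ?g (i, N + 1 - i))"
    by (subst sum.reindex) (auto simp: inj_on_def)
  also have "\<dots> = ob_coalg sA N D"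
    unfolding ob_coalg_def by (rule sum.cong) (auto simp: truncate_def conv_def)
  finally show ?thesis ..
qed

lemma assoc_defect_truncate:
  assumes "coassociative_mod sA N D" "m \<le> N"
  shows "assoc_defect sA (truncate N D) m = 0"
proof -
  have eq: "idx2 m = {(i, j). i \<le> N \<and> j \<le> N \<and> i + j = m}"
    using assms(2) by (auto simp: idx2_def)
  have "(\<Sum>(i, j)\<in>idx2 m. tmap sA [idt sA, D i] \<circ> D j) = (\<Sum>(i, j)\<in>idx2 m. tmap sA [D i, idt sA] \<circ> D j)"
    using assms unfolding coassociative_mod_def eq by blast
  moreover have "assoc_defect sA (truncate N D) m
    = (\<Sum>(i, j)\<in>idx2 m. (tmap sA [D i, idt sA] \<circ> D j) - (tmap sA [idt sA, D i] \<circ> D j))"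
    unfolding assoc_defect_def by (rule sum.cong) (auto simp: eq truncate_def conv_def)
  ultimately show ?thesis
    by (simp only: sum_subtractf_split diff_self)
qed

text \<open>Every tuple with an entry above \<open>N\<close> contains a zero factor, which
  annihilates its term; the surviving tuples are those of the obstruction.\<close>

lemma ob_mor_eq_mor_defect:
  fixes sB :: "'k::field \<Rightarrow> 'b::ab_group_add \<Rightarrow> 'b"
  assumes B: "vector_space sB" and DA: "\<And>n. n \<le> N \<Longrightarrow> tensor_map sA sA 2 (DA n)"
    and DB: "\<And>n. n \<le> N \<Longrightarrow> tensor_map sB sB 2 (DB n)"
    and F: "\<And>n. n \<le> N \<Longrightarrow> Vector_Spaces.linear sA sB (F n)"
  shows "ob_mor sB N DA DB F = mor_defect sB (truncate N DA) (truncate N DB) (truncate N F) (N + 1)"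
proof -
  let ?A = "truncate N DA" and ?B = "truncate N DB" and ?F = "truncate N F"
  note A = tensor_mapD(1)[OF DA[OF le0]]
  have EA: "tensor_map sA sA 2 (?A n)" for n
    using DA tensor_map_zero[OF A A] by (simp add: truncate_def)
  have z0: "Vector_Spaces.linear sA sB 0"
    using A B vector_space_pair.linear_zero[OF vector_space_pair.intro] by (simp add: zero_fun_def)
  have EF: "Vector_Spaces.linear sA sB (?F n)" for n
    using F z0 by (simp add: truncate_def)
  have f: "tensor_map sA sB 1 (idt sB \<circ> ?F n)" for n
    by (rule tensor_map_comp[OF tensor_map_idt[OF B] EF])
  have i0: "idt sB 0 = 0" by (rule linear_at_zero[OF tensor_mapD(3)[OF tensor_map_idt[OF B]]])
  have c0: "conv sB 0 g h = 0" for g h :: "'a \<Rightarrow> ('b list, 'k) tensor"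
    unfolding conv_def by (rule tmap_comp_zero)
  have f0: "idt sB \<circ> 0 = 0" by (simp add: fun_eq_iff i0)
  have ge: "?A n = 0" "?B n = 0" "?F n = 0" if "\<not> n \<le> N" for n
    using that by (simp_all add: truncate_def)
  let ?J = "{(i, j, k). i + j + k = N + 1 \<and> i \<le> N \<and> j \<le> N \<and> k \<le> N}"
  let ?c = "\<lambda>(i, j, k). conv sB (?A i) (idt sB \<circ> ?F j) (idt sB \<circ> ?F k)"
  have "sum ?c (idx3 (N + 1)) = sum ?c ?J"
  proof (rule sum.mono_neutral_right[OF finite_idx(2)])
    show "\<forall>x\<in>idx3 (N + 1) - ?J. ?c x = 0"
    proof
      fix x assume "x \<in> idx3 (N + 1) - ?J"
      then obtain i j k where x: "x = (i, j, k)" and "\<not> i \<le> N \<or> \<not> j \<le> N \<or> \<not> k \<le> N"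
        by (cases x) (auto simp: idx3_def)
      then show "?c x = 0"
        by (elim disjE) (simp_all only: split ge f0 c0 conv_zero_left[OF EA f] conv_zero_right[OF EA f]
              not_False_eq_True)
    qed
  qed (auto simp: idx3_def)
  also have "\<dots> = (\<Sum>(i, j, k)\<in>?J. tmap sB [idt sB \<circ> F j, idt sB \<circ> F k] \<circ> DA i)"
    by (rule sum.cong) (auto simp: truncate_def conv_def)
  finally have 1: "sum ?c (idx3 (N + 1)) = \<dots>" .
  let ?d = "\<lambda>(i, j). ?B i \<circ> ?F j"
  \<comment> \<open>For the pair (0, N + 1) the zero map is applied first, so the composite vanishes
    because the linear map \<open>?B 0\<close> sends 0 to 0.\<close>
  have B0: "?B n 0 = 0" for n
    using linear_at_zero[OF tensor_mapD(3)[OF DB]] by (simp add: truncate_def)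
  \<comment> \<open>The parameter \<open>i\<close> is the index of \<open>F\<close>, as in the
    obstruction, so it is the second entry of the pair.\<close>
  have "sum ?d (idx2 (N + 1)) = sum ?d ((\<lambda>i. (N + 1 - i, i)) ` {1..N})"
  proof (rule sum.mono_neutral_right[OF finite_idx(1)])
    show "\<forall>x\<in>idx2 (N + 1) - (\<lambda>i. (N + 1 - i, i)) ` {1..N}. ?d x = 0"
    proof
      fix x assume "x \<in> idx2 (N + 1) - (\<lambda>i. (N + 1 - i, i)) ` {1..N}"
      then have "x = (0, Suc N) \<or> x = (Suc N, 0)"
        by (cases x) (auto simp: idx2_def image_iff)
      then show "?d x = 0"
        using B0 by (auto simp: ge fun_eq_iff)
    qed
  qed (auto simp: idx2_def)
  also have "\<dots> = (\<Sum>i = 1..N. ?d (N + 1 - i, i))"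
    by (subst sum.reindex) (auto simp: inj_on_def)
  also have "\<dots> = (\<Sum>i = 1..N. DB (N + 1 - i) \<circ> F i)"
    by (rule sum.cong) (auto simp: truncate_def)
  finally show ?thesis
    unfolding ob_mor_def mor_defect_def 1 by (simp only:)
qed

lemma mor_defect_truncate:
  assumes "morphism_mod sB N DA DB F" "m \<le> N"
  shows "mor_defect sB (truncate N DA) (truncate N DB) (truncate N F) m = 0"
proof -
  have eq2: "{(i, j). i \<le> N \<and> j \<le> N \<and> i + j = m} = idx2 m"
    using assms(2) by (auto simp: idx2_def)
  have eq3: "{(i, j, k). i \<le> N \<and> j \<le> N \<and> k \<le> N \<and> i + j + k = m} = idx3 m"
    using assms(2) by (auto simp: idx3_def)
  have "(\<Sum>(i, j)\<in>idx2 m. DB i \<circ> F j)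
    = (\<Sum>(i, j, k)\<in>idx3 m. tmap sB [idt sB \<circ> F j, idt sB \<circ> F k] \<circ> DA i)"
    using assms unfolding morphism_mod_def eq2[symmetric] eq3[symmetric] by blast
  moreover have "(\<Sum>(i, j)\<in>idx2 m. truncate N DB i \<circ> truncate N F j) = (\<Sum>(i, j)\<in>idx2 m. DB i \<circ> F j)"
    by (rule sum.cong) (auto simp flip: eq2 simp: truncate_def)
  moreover have "(\<Sum>(i, j, k)\<in>idx3 m. conv sB (truncate N DA i) (idt sB \<circ> truncate N F j) (idt sB \<circ> truncate N F k))
    = (\<Sum>(i, j, k)\<in>idx3 m. tmap sB [idt sB \<circ> F j, idt sB \<circ> F k] \<circ> DA i)"
    by (rule sum.cong) (auto simp flip: eq3 simp: truncate_def conv_def)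
  ultimately show ?thesis
    unfolding mor_defect_def by (simp only: diff_self)
qed

lemma coch_iff_tensor_map:
  "n > 0 \<Longrightarrow> vector_space sB \<Longrightarrow> \<sigma> \<in> coch sA sB n \<longleftrightarrow> tensor_map sA sB n \<sigma>"
  by (auto simp: coch_def tensor_map_def)

theorem theorem4p2:
  fixes sA :: "'k::field \<Rightarrow> 'a::ab_group_add \<Rightarrow> 'a"
    and sB :: "'k \<Rightarrow> 'b::ab_group_add \<Rightarrow> 'b"
    and \<Delta>A :: "'a \<Rightarrow> ('a list, 'k) tensor"
    and \<Delta>B :: "'b \<Rightarrow> ('b list, 'k) tensor"
    and f :: "'a \<Rightarrow> 'b"
    and N :: nat
    and DA :: "nat \<Rightarrow> 'a \<Rightarrow> ('a list, 'k) tensor"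
    and DB :: "nat \<Rightarrow> 'b \<Rightarrow> ('b list, 'k) tensor"
    and F :: "nat \<Rightarrow> 'a \<Rightarrow> 'b"
  assumes "coalgebra sA \<Delta>A" and "coalgebra sB \<Delta>B"
    and "coalgebra_morphism sA \<Delta>A sB \<Delta>B f"
    and "N \<ge> 1"
    and "deformation sA \<Delta>A sB \<Delta>B f N DA DB F"
  shows "(ob_coalg sA N DA, ob_coalg sB N DB, ob_mor sB N DA DB F) \<in> def_coch sA sB 3
    \<and> def_diff sA \<Delta>A sB \<Delta>B f 3 (ob_coalg sA N DA, ob_coalg sB N DB, ob_mor sB N DA DB F)
           = (0, 0, 0)"
proof -
  have A: "vector_space sA" and B: "vector_space sB"
    using assms(1,2) by (auto simp: coalgebra_def)
  have coch: "DA n \<in> coch sA sA 2" "DB n \<in> coch sB sB 2" "idt sB \<circ> F n \<in> coch sA sB 1" if "n \<le> N" for n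
    using assms(5) that by (auto simp: deformation_def def_coch_def)
  have DA: "tensor_map sA sA 2 (DA n)" and DB: "tensor_map sB sB 2 (DB n)"
    and F: "Vector_Spaces.linear sA sB (F n)" if "n \<le> N" for n
    using coch[OF that] A B linear_of_idt_comp[OF B]
    by (auto simp: coch_iff_tensor_map dest: tensor_mapD(3))
  let ?A = "truncate N DA" and ?B = "truncate N DB" and ?F = "truncate N F"
  have EA: "tensor_map sA sA 2 (?A n)" and EB: "tensor_map sB sB 2 (?B n)" for n
    using DA DB tensor_map_zero[OF A A] tensor_map_zero[OF B B] by (auto simp: truncate_def)
  have "Vector_Spaces.linear sA sB 0"
    using A B vector_space_pair.linear_zero[OF vector_space_pair.intro] by (simp add: zero_fun_def)
  with F have EF: "Vector_Spaces.linear sA sB (?F n)" for n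
    by (auto simp: truncate_def)
  have start: "?A 0 = \<Delta>A" "?B 0 = \<Delta>B" "?F 0 = f"
    and mods: "coassociative_mod sA N DA" "coassociative_mod sB N DB" "morphism_mod sB N DA DB F"
    using assms(5) by (auto simp: deformation_def truncate_def)
  note zeroA = assoc_defect_truncate[OF mods(1)] and zeroB = assoc_defect_truncate[OF mods(2)]
    and zeroF = mor_defect_truncate[OF mods(3)]
  have obs: "ob_coalg sA N DA = assoc_defect sA ?A (N + 1)"
    "ob_coalg sB N DB = assoc_defect sB ?B (N + 1)"
    "ob_mor sB N DA DB F = mor_defect sB ?A ?B ?F (N + 1)"
    by (rule ob_coalg_eq_assoc_defect[OF DA A] ob_coalg_eq_assoc_defect[OF DB B]
        ob_mor_eq_mor_defect[OF B DA DB F]; assumption)+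
  have "diff_self sA \<Delta>A 3 (ob_coalg sA N DA) = 0" "diff_self sB \<Delta>B 3 (ob_coalg sB N DB) = 0"
    unfolding obs start[symmetric]
    \<comment> \<open>The defects must vanish at each \<open>i < N + 1\<close>, that is
      \<open>i \<le> N\<close>, which is what the equations of the deformation provide.\<close>
    by (rule diff_self_assoc_defect[OF EA] diff_self_assoc_defect[OF EB]; simp only: zeroA zeroB less_Suc_eq_le Suc_eq_plus1[symmetric])+
  moreover have "diff_mor sA \<Delta>A sB \<Delta>B f 2 (ob_mor sB N DA DB F)
    = (ob_coalg sB N DB \<circ> f) - (tmap sB [idt sB \<circ> f, idt sB \<circ> f, idt sB \<circ> f] \<circ> ob_coalg sA N DA)"
    unfolding obs start[symmetric]
    by (rule diff_mor_mor_defect[OF EA EB EF]; simp only: zeroA zeroB zeroF less_Suc_eq_le Suc_eq_plus1[symmetric])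
  moreover have "(ob_coalg sA N DA, ob_coalg sB N DB, ob_mor sB N DA DB F) \<in> def_coch sA sB 3"
    unfolding obs def_coch_def
    using tensor_map_assoc_defect[of sA ?A, OF EA] tensor_map_assoc_defect[of sB ?B, OF EB]
      tensor_map_mor_defect[OF EA EB EF]
    by (simp add: coch_iff_tensor_map A B)
  \<comment> \<open>The third component of the differential is zero because the differential of the
    morphism obstruction equals the other two terms of that component.\<close>
  ultimately show ?thesis
    by (simp add: def_diff_def numeral_3_eq_3 numeral_2_eq_2)
qed

end
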